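(* Let $m,n\ge 2$ be integers and let $\phi: M_{mn}\rightarrow M_{mn}$ be a (complex-)linear map. The following are equivalent. (a) $w(\phi(A\otimes B)) = w(A\otimes B)$ for all $A\in M_m$ and $B\in M_n$. (b) There exist a unitary matrix $U\in M_{mn}$, a complex number $\xi$ with $|\xi|=1$, and maps $\varphi_1: M_m\to M_m$, $\varphi_2: M_n\to M_n$, each of which is either the identity map $X\mapsto X$ or the transposition map $X\mapsto X^t$, such that $$\phi(A\otimes B) = \xi\, U(\varphi_1(A)\otimes \varphi_2(B))U^* \quad\text{for all } A\in M_m \text{ and } B\in M_n,$$ and, if both $m\ge 3$ and $n\ge 3$, the maps $\varphi_1$ and $\varphi_2$ are of the same type (both the identity map or both the transposition map).
   Context: $M_k$ denotes the set of $k\times k$ complex matrices. $A\otimes B\in M_{mn}$ is the tensor (Kronecker) product of $A\in M_m$ and $B\in M_n$. $X^t$ is the transpose and $X^*$ the conjugate transpose of $X$. For $A\in M_k$, the numerical range is $W(A)=\{u^*Au : u\in\mathbb{C}^k,\ u^*u=1\}\subseteq\mathbb{C}$, and the numerical radius is $w(A)=\sup\{|\mu| : \mu\in W(A)\}$. *)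

theory Defs
  imports "HOL-Analysis.Analysis"
begin

type_synonym 'k cmat = "complex ^ 'k ^ 'k"

definition mat_scale :: "complex \<Rightarrow> complex ^ 'b ^ 'a \<Rightarrow> complex ^ 'b ^ 'a"
  where "mat_scale c X = map_matrix (\<lambda>x. c * x) X"

lemma mat_scale_nth [simp]: "mat_scale c X $ i $ j = c * X $ i $ j"
  by (simp add: mat_scale_def)

lemma vector_space_mat_scale:
  "vector_space (mat_scale :: complex \<Rightarrow> complex ^ 'b ^ 'a \<Rightarrow> complex ^ 'b ^ 'a)"
  by unfold_locales (simp_all add: vec_eq_iff algebra_simps)

text \<open>The constant \<open>linear\<close> of \<open>HOL-Analysis\<close> means real-linear; this is linearity over the
  complex numbers.\<close>

definition complex_linear :: "(complex ^ 'b ^ 'a \<Rightarrow> complex ^ 'd ^ 'c) \<Rightarrow> bool"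
  where "complex_linear \<phi> \<longleftrightarrow> Vector_Spaces.linear mat_scale mat_scale \<phi>"

lemma complex_linear_iff:
  "complex_linear \<phi> \<longleftrightarrow>
    (\<forall>X Y. \<phi> (X + Y) = \<phi> X + \<phi> Y) \<and> (\<forall>c X. \<phi> (mat_scale c X) = mat_scale c (\<phi> X))"
  unfolding complex_linear_def
  by (simp add: Vector_Spaces.linear_iff vector_space_mat_scale)

definition conj_transpose :: "complex ^ 'b ^ 'a \<Rightarrow> complex ^ 'a ^ 'b"
  where "conj_transpose X = map_matrix cnj (transpose X)"

definition unitary :: "'k::finite cmat \<Rightarrow> bool"
  where "unitary U \<longleftrightarrow> conj_transpose U ** U = mat 1 \<and> U ** conj_transpose U = mat 1"

text \<open>The index type of a Kronecker product is the product of the index types, so that \<open>M\<^sub>m\<^sub>n\<close>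
  is rendered as \<open>('m \<times> 'n) cmat\<close>; the pair \<open>(i, k)\<close> takes the place of the usual
  lexicographic position \<open>i n + k\<close>.\<close>

definition kronecker :: "complex ^ 'b ^ 'a \<Rightarrow> complex ^ 'd ^ 'c \<Rightarrow> complex ^ ('b \<times> 'd) ^ ('a \<times> 'c)"
    (infixr "\<otimes>" 71)
  where "A \<otimes> B = (\<chi> p q. A $ fst p $ fst q * B $ snd p $ snd q)"

text \<open>\<open>u\<^sup>* v\<close> for column vectors \<open>u\<close> and \<open>v\<close>\<close>

definition cdot :: "complex ^ 'k \<Rightarrow> complex ^ 'k \<Rightarrow> complex"
  where "cdot u v = (\<Sum>i\<in>UNIV. cnj (u $ i) * v $ i)"

definition numerical_range :: "'k::finite cmat \<Rightarrow> complex set"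
  where "numerical_range A = {cdot u (A *v u) | u. cdot u u = 1}"

definition numerical_radius :: "'k::finite cmat \<Rightarrow> real"
  where "numerical_radius A = Sup {cmod \<mu> | \<mu>. \<mu> \<in> numerical_range A}"

text \<open>The supremum is taken over a nonempty bounded set.\<close>

lemma cdot_self: "cdot u u = of_real ((norm u)\<^sup>2)"
  by (simp add: cdot_def norm_vec_def L2_set_def sum_nonneg mult.commute[of "cnj _"]
      complex_norm_square[symmetric])

lemma numerical_range_nonempty: "numerical_range A \<noteq> {}"
proof -
  have "cdot (axis i 1) (axis i 1 :: complex ^ 'a) = 1" for i :: 'a
    by (simp add: cdot_self)
  then show ?thesis
    unfolding numerical_range_def by blast
qed

lemma numerical_range_bdd_above: "bdd_above {cmod \<mu> | \<mu>. \<mu> \<in> numerical_range A}"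
proof (rule bdd_aboveI)
  fix r assume "r \<in> {cmod \<mu> | \<mu>. \<mu> \<in> numerical_range A}"
  then obtain u where r: "r = cmod (cdot u (A *v u))" and "cdot u u = 1"
    by (auto simp: numerical_range_def)
  then have "(norm u)\<^sup>2 = 1"
    by (metis cdot_self of_real_eq_1_iff)
  then have "norm u = 1"
    using power2_eq_1_iff[of "norm u"] norm_ge_zero[of u] by linarith
  then have u: "cmod (u $ i) \<le> 1" for i
    using Finite_Cartesian_Product.norm_nth_le[of u i] by simp
  have "r \<le> (\<Sum>i\<in>UNIV. cmod (cnj (u $ i) * (A *v u) $ i))"
    unfolding r cdot_def by (rule norm_sum)
  also have "\<dots> \<le> (\<Sum>i\<in>UNIV. cmod ((A *v u) $ i))"
    by (intro sum_mono) (simp add: norm_mult mult_left_le_one_le u)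
  also have "\<dots> \<le> (\<Sum>i\<in>UNIV. \<Sum>j\<in>UNIV. cmod (A $ i $ j))"
  proof (rule sum_mono)
    fix i
    have "cmod ((A *v u) $ i) \<le> (\<Sum>j\<in>UNIV. cmod (A $ i $ j * u $ j))"
      unfolding matrix_vector_mult_def by (simp add: norm_sum)
    also have "\<dots> \<le> (\<Sum>j\<in>UNIV. cmod (A $ i $ j))"
      by (intro sum_mono) (simp add: norm_mult mult_right_le_one_le u)
    finally show "cmod ((A *v u) $ i) \<le> (\<Sum>j\<in>UNIV. cmod (A $ i $ j))" .
  qed
  finally show "r \<le> (\<Sum>i\<in>UNIV. \<Sum>j\<in>UNIV. cmod (A $ i $ j))" .
qed

end

theory Submission
  imports Defs
begin

text \<open>
  The implication from (b) to (a) rests on the invariance of the numerical radius \<open>w\<close> under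
  unitary similarity, under phases and under transposition of the whole matrix. When one
  factor is two-dimensional, a transposition of that factor alone is harmless too, because
  every 2-by-2 matrix is unitarily similar to its transpose
  (\<open>transpose_unitarily_similar_2\<close>). From dimension 3 on in both factors, a weighted shift
  \<open>S\<close> has \<open>w (S \<otimes> S\<^sup>t) < w (S \<otimes> S)\<close>, which forces the two types to agree
  (\<open>partial_transpose_not_radius_preserving\<close>).

  For the implication from (a) to (b), the first idea is to look at a unit vector \<open>u\<close> at which
  the numerical radius 1 is attained. After multiplication of the matrix by a phase, \<open>u\<close> is
  an eigenvector of its Hermitian part (\<open>contact_vector_eigen\<close>). If the numerical radius of
  \<open>X + a Y\<close> stays at most 1 for all phases \<open>a\<close> and \<open>u\<close> is a contact vector of \<open>X\<close>, then \<open>Y\<close>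
  and its adjoint annihilate \<open>u\<close> (\<open>contact_vector_kernel\<close>). Consequently \<open>\<phi>\<close> maps the
  projections of an orthonormal product basis to phases times the projections of an
  orthonormal basis. The phases are all equal, since the trace of the image is a form of
  constant modulus on product vectors. So \<open>\<phi>\<close> becomes, after division by one phase and a
  unitary similarity, a map that fixes the diagonal matrix units and sends product states to
  positive rank-one matrices (\<open>radius_preserving_normalize\<close>).

  The second idea is to read the entries of the image of \<open>x x\<^sup>* \<otimes> y y\<^sup>*\<close> as sesquilinear forms
  in \<open>x\<close> and in \<open>y\<close>. Positivity determines the diagonal entries, hence, since the image has
  rank one, the moduli of all entries: they are the same as those of \<open>x x\<^sup>* \<otimes> y y\<^sup>*\<close>. A form
  of modulus \<open>\<bar>x\<^sub>i x\<^sub>k\<bar>\<close> is a constant times \<open>x\<^sub>i cnj x\<^sub>k\<close> or times its conjugate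
  (\<open>modulus_product_functional_outer\<close>), and the 2-by-2 minors of rank-one matrices exclude
  that the two kinds are mixed within a factor and factor the constants into phases
  (\<open>product_rank_one_classification\<close>). The phases form a diagonal unitary matrix, which is
  absorbed into \<open>U\<close>.
\<close>

section \<open>Inner products, adjoints and Kronecker products\<close>

definition outer :: "complex ^ 'a \<Rightarrow> complex ^ 'b \<Rightarrow> complex ^ 'b ^ 'a"
  where "outer u v = (\<chi> i j. u $ i * cnj (v $ j))"

definition conj_vec :: "complex ^ 'a \<Rightarrow> complex ^ 'a"
  where "conj_vec u = (\<chi> i. cnj (u $ i))"

definition mat_unit :: "'a \<Rightarrow> 'b \<Rightarrow> complex ^ 'b ^ 'a"
  where "mat_unit i k = (\<chi> a b. if a = i \<and> b = k then 1 else 0)"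

definition diag_mat :: "('a::finite \<Rightarrow> complex) \<Rightarrow> 'a cmat"
  where "diag_mat d = (\<chi> a b. if a = b then d a else 0)"

lemma outer_nth [simp]: "outer u v $ i $ j = u $ i * cnj (v $ j)"
  by (simp add: outer_def)

lemma mat_unit_nth [simp]: "mat_unit i k $ a $ b = (if a = i \<and> b = k then 1 else 0)"
  by (simp add: mat_unit_def)

lemma conj_vec_nth [simp]: "conj_vec u $ i = cnj (u $ i)"
  by (simp add: conj_vec_def)

lemma diag_mat_nth [simp]: "diag_mat d $ a $ b = (if a = b then d a else 0)"
  by (simp add: diag_mat_def)

lemma kronecker_nth [simp]: "(A \<otimes> B) $ p $ q = A $ fst p $ fst q * B $ snd p $ snd q"
  by (simp add: kronecker_def)

lemma conj_transpose_nth [simp]: "conj_transpose A $ i $ j = cnj (A $ j $ i)"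
  by (simp add: conj_transpose_def transpose_def map_matrix_def)

lemma transpose_nth [simp]: "transpose A $ i $ j = A $ j $ i"
  by (simp add: transpose_def)

lemma axis_nth: "axis i c $ j = (if j = i then c else 0)"
  by (simp add: axis_def)

lemma cdot_add_right: "cdot u (v + w) = cdot u v + cdot u w"
  by (simp add: cdot_def algebra_simps sum.distrib)

lemma cdot_add_left: "cdot (u + v) w = cdot u w + cdot v w"
  by (simp add: cdot_def algebra_simps sum.distrib)

lemma cdot_scale_right: "cdot u (c *s v) = c * cdot u v"
  by (simp add: cdot_def algebra_simps sum_distrib_left)

lemma cdot_scale_left: "cdot (c *s u) v = cnj c * cdot u v"
  by (simp add: cdot_def algebra_simps sum_distrib_left)

lemma cdot_diff_right: "cdot u (v - w) = cdot u v - cdot u w"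
  by (simp add: cdot_def algebra_simps sum_subtractf)

lemma cdot_zero_right [simp]: "cdot u 0 = 0"
  and cdot_zero_left [simp]: "cdot 0 u = 0"
  by (simp_all add: cdot_def)

lemma cdot_commute: "cdot v u = cnj (cdot u v)"
  by (simp add: cdot_def mult.commute)

lemma cdot_self_eq_1: "cdot u u = 1 \<longleftrightarrow> norm u = 1"
proof -
  have "cdot u u = 1 \<longleftrightarrow> (norm u)\<^sup>2 = 1"
    by (metis cdot_self of_real_eq_1_iff)
  also have "\<dots> \<longleftrightarrow> norm u = 1"
    using norm_ge_zero[of u] by (auto simp: power2_eq_1_iff simp del: norm_ge_zero)
  finally show ?thesis .
qed

lemma cdot_adjoint: "cdot u (A *v v) = cdot (conj_transpose A *v u) v"
proof -
  have "cdot u (A *v v) = (\<Sum>i\<in>UNIV. \<Sum>j\<in>UNIV. cnj (u $ i) * A $ i $ j * v $ j)"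
    by (simp add: cdot_def matrix_vector_mult_def sum_distrib_left mult.assoc)
  also have "\<dots> = (\<Sum>j\<in>UNIV. \<Sum>i\<in>UNIV. cnj (u $ i) * A $ i $ j * v $ j)"
    by (rule sum.swap)
  also have "\<dots> = cdot (conj_transpose A *v u) v"
    by (simp add: cdot_def matrix_vector_mult_def sum_distrib_left sum_distrib_right mult_ac)
  finally show ?thesis .
qed

lemma cdot_axis: "cdot w (axis i 1) = cnj (w $ i)" "cdot (axis i 1) w = w $ i"
  by (simp_all add: cdot_def axis_nth if_distrib if_distribR cong: if_cong)

lemma mult_axis_nth: "(A *v axis r 1) $ q = (A :: complex ^ 'b::finite ^ 'a) $ q $ r"
  by (simp add: matrix_vector_mult_def axis_nth if_distrib if_distribR cong: if_cong)

lemma norm_square_sum: "(norm (u :: complex ^ 'k::finite))\<^sup>2 = (\<Sum>p\<in>UNIV. (cmod (u $ p))\<^sup>2)"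
  by (simp add: norm_vec_def L2_set_def sum_nonneg)

lemma conj_transpose_conj_transpose [simp]: "conj_transpose (conj_transpose A) = A"
  by (simp add: vec_eq_iff)

lemma cdot_adjoint': "cdot u (conj_transpose A *v v) = cdot (A *v u) v"
  by (simp add: cdot_adjoint)

lemma conj_transpose_mult: "conj_transpose (A ** B) = conj_transpose B ** conj_transpose A"
  by (simp add: vec_eq_iff matrix_matrix_mult_def mult.commute)

lemma conj_transpose_scale: "conj_transpose (mat_scale c A) = mat_scale (cnj c) (conj_transpose A)"
  by (simp add: vec_eq_iff)

lemma conj_transpose_add: "conj_transpose (A + B) = conj_transpose A + conj_transpose B"
  by (simp add: vec_eq_iff)

lemma conj_transpose_one [simp]: "conj_transpose (mat 1) = (mat 1 :: 'k::finite cmat)"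
  by (simp add: vec_eq_iff mat_def)

lemma mat_add_mult_left: "(A + B) ** C = A ** C + B ** (C :: complex ^ 'c ^ 'b::finite)"
  by (simp add: vec_eq_iff matrix_matrix_mult_def algebra_simps sum.distrib)

lemma mat_mult_diff_left: "(A - B) ** C = A ** C - B ** (C :: complex ^ 'c ^ 'b::finite)"
  by (simp add: vec_eq_iff matrix_matrix_mult_def algebra_simps sum_subtractf)

lemma mat_mult_diff_right: "A ** (B - C) = A ** B - A ** (C :: complex ^ 'c ^ 'b::finite)"
  by (simp add: vec_eq_iff matrix_matrix_mult_def algebra_simps sum_subtractf)

lemma mat_scale_mult_left: "mat_scale c A ** B = mat_scale c (A ** B)"
  by (simp add: vec_eq_iff matrix_matrix_mult_def sum_distrib_left mult.assoc)

lemma mat_scale_mult_right: "A ** mat_scale c B = mat_scale c (A ** B)"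
  by (simp add: vec_eq_iff matrix_matrix_mult_def sum_distrib_left mult_ac)

lemma mat_scale_mult_vec: "mat_scale c A *v u = c *s (A *v u)"
  by (simp add: vec_eq_iff matrix_vector_mult_def sum_distrib_left mult.assoc)

lemma mat_scale_scale [simp]: "mat_scale c (mat_scale d A) = mat_scale (c * d) A"
  by (simp add: vec_eq_iff)

lemma mat_scale_one [simp]: "mat_scale 1 A = A"
  by (simp add: vec_eq_iff)

lemma mat_scale_zero [simp]: "mat_scale 0 A = 0"
  by (simp add: vec_eq_iff)

lemma conj_transpose_kronecker: "conj_transpose (A \<otimes> B) = conj_transpose A \<otimes> conj_transpose B"
  by (simp add: vec_eq_iff)

lemma transpose_kronecker: "transpose (A \<otimes> B) = transpose A \<otimes> transpose B"
  by (simp add: vec_eq_iff)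

lemma kronecker_mult:
  fixes A :: "complex ^ 'b::finite ^ 'a" and B :: "complex ^ 'd::finite ^ 'c"
  shows "(A \<otimes> B) ** (C \<otimes> D) = (A ** C) \<otimes> (B ** D)"
proof -
  have "(\<Sum>r\<in>UNIV. A $ fst p $ fst r * B $ snd p $ snd r * (C $ fst r $ fst q * D $ snd r $ snd q))
      = (\<Sum>a\<in>UNIV. A $ fst p $ a * C $ a $ fst q) * (\<Sum>b\<in>UNIV. B $ snd p $ b * D $ b $ snd q)"
    for p q
    by (simp add: sum_product UNIV_Times_UNIV[symmetric] sum.cartesian_product split_def mult_ac
        del: UNIV_Times_UNIV)
  then show ?thesis
    by (simp add: vec_eq_iff matrix_matrix_mult_def)
qed

lemma kronecker_add_left: "(A + B) \<otimes> C = A \<otimes> C + B \<otimes> C"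
  by (simp add: vec_eq_iff algebra_simps)

lemma kronecker_add_right: "A \<otimes> (B + C) = A \<otimes> B + A \<otimes> C"
  by (simp add: vec_eq_iff algebra_simps)

lemma kronecker_scale_left: "mat_scale c A \<otimes> B = mat_scale c (A \<otimes> B)"
  by (simp add: vec_eq_iff algebra_simps)

lemma kronecker_scale_right: "A \<otimes> mat_scale c B = mat_scale c (A \<otimes> B)"
  by (simp add: vec_eq_iff algebra_simps)

lemmas kronecker_linear = kronecker_add_left kronecker_add_right kronecker_scale_left
  kronecker_scale_right

lemma kronecker_one: "(mat 1 :: 'a::finite cmat) \<otimes> (mat 1 :: 'b::finite cmat) = mat 1"
  by (auto simp: vec_eq_iff mat_def prod_eq_iff)

lemma unitaryD: "unitary U \<Longrightarrow> conj_transpose U ** U = mat 1"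
  "unitary U \<Longrightarrow> U ** conj_transpose U = mat 1"
  by (simp_all add: unitary_def)

lemma unitaryI: "conj_transpose U ** U = mat 1 \<Longrightarrow> unitary U"
  by (simp add: unitary_def matrix_left_right_inverse)

lemma unitary_conj_transpose: "unitary U \<Longrightarrow> unitary (conj_transpose U)"
  by (simp add: unitary_def)

lemma unitary_cancel: "unitary U \<Longrightarrow> conj_transpose U ** (U ** A) = A"
  "unitary U \<Longrightarrow> U ** (conj_transpose U ** A) = A"
  by (simp_all add: matrix_mul_assoc unitaryD)

lemma unitary_mult: "unitary U \<Longrightarrow> unitary V \<Longrightarrow> unitary (U ** V)"
  by (rule unitaryI)
    (simp add: conj_transpose_mult unitary_cancel unitaryD flip: matrix_mul_assoc)

lemma unitary_one: "unitary (mat 1)"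
  by (simp add: unitary_def)

lemma unitary_kronecker: "unitary V \<Longrightarrow> unitary W \<Longrightarrow> unitary (V \<otimes> W)"
  by (simp add: unitary_def conj_transpose_kronecker kronecker_mult kronecker_one)

lemma cnj_mult_self: "cmod c = 1 \<Longrightarrow> cnj c * c = 1" "cmod c = 1 \<Longrightarrow> c * cnj c = 1"
  by (metis complex_norm_square mult.commute of_real_1 one_power2)+

lemma diag_mat_mult: "diag_mat d ** diag_mat e = diag_mat (\<lambda>a. d a * e a)"
proof -
  have "(\<Sum>k\<in>UNIV. diag_mat d $ i $ k * diag_mat e $ k $ j) = (if i = j then d i * e i else 0)" for i j
  proof -
    have "(\<Sum>k\<in>UNIV. diag_mat d $ i $ k * diag_mat e $ k $ j)
        = (\<Sum>k\<in>UNIV. if k = i then d i * (if i = j then e i else 0) else 0)"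
      by (rule sum.cong) auto
    then show ?thesis by simp
  qed
  then show ?thesis
    by (simp add: vec_eq_iff matrix_matrix_mult_def)
qed

lemma conj_transpose_diag_mat: "conj_transpose (diag_mat d) = diag_mat (\<lambda>a. cnj (d a))"
  by (simp add: vec_eq_iff)

lemma unitary_diag_mat: "(\<And>a. cmod (d a) = 1) \<Longrightarrow> unitary (diag_mat d)"
  by (rule unitaryI)
    (simp add: conj_transpose_diag_mat diag_mat_mult cnj_mult_self vec_eq_iff mat_def)

lemma unitary_scale: "cmod c = 1 \<Longrightarrow> unitary U \<Longrightarrow> unitary (mat_scale c U)"
  by (rule unitaryI)
    (simp add: conj_transpose_scale mat_scale_mult_left mat_scale_mult_right cnj_mult_self unitaryD)

lemma unitary_conj_cancel:
  "unitary U \<Longrightarrow> conj_transpose U ** (U ** A ** conj_transpose U) ** U = A"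
  "unitary U \<Longrightarrow> U ** (conj_transpose U ** A ** U) ** conj_transpose U = A"
  by (simp_all add: unitary_cancel unitaryD flip: matrix_mul_assoc)

lemma unitary_norm: "unitary U \<Longrightarrow> norm (U *v u) = norm u"
proof -
  assume "unitary U"
  then have "cdot (U *v u) (U *v u) = cdot u u"
    by (simp add: cdot_adjoint matrix_vector_mul_assoc unitaryD)
  then have "(norm (U *v u))\<^sup>2 = (norm u)\<^sup>2"
    by (metis cdot_self of_real_eq_iff)
  then show ?thesis by simp
qed

lemma cdot_conj_mult: "cdot u ((U ** A ** conj_transpose U) *v u)
    = cdot (conj_transpose U *v u) (A *v (conj_transpose U *v u))"
  by (simp add: cdot_adjoint matrix_vector_mul_assoc[symmetric])

lemma outer_mult_vec: "outer u v *v w = cdot v w *s u"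
  by (simp add: vec_eq_iff matrix_vector_mult_def cdot_def sum_distrib_right sum_distrib_left mult_ac)

lemma outer_conj: "A ** outer u v ** conj_transpose B = outer (A *v u) (B *v v)"
  by (simp add: vec_eq_iff matrix_matrix_mult_def matrix_vector_mult_def sum_product
      sum_distrib_right sum_distrib_left mult_ac)

lemma outer_axis: "outer (axis i 1) (axis k 1) = mat_unit i k"
  by (simp add: vec_eq_iff axis_nth)

lemma outer_scale: "outer (c *s u) (d *s v) = mat_scale (c * cnj d) (outer u v)"
  by (simp add: vec_eq_iff)

section \<open>The numerical radius\<close>

lemma numerical_radius_le:
  assumes "\<And>u. norm u = 1 \<Longrightarrow> cmod (cdot u (A *v u)) \<le> c"
  shows "numerical_radius A \<le> c"
  unfolding numerical_radius_def
proof (rule cSup_least)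
  show "{cmod \<mu> |\<mu>. \<mu> \<in> numerical_range A} \<noteq> {}"
    using numerical_range_nonempty by blast
next
  fix r assume "r \<in> {cmod \<mu> |\<mu>. \<mu> \<in> numerical_range A}"
  then obtain u where "r = cmod (cdot u (A *v u))" "cdot u u = 1"
    by (auto simp: numerical_range_def)
  moreover from this have "norm u = 1"
    by (simp add: cdot_self_eq_1)
  ultimately show "r \<le> c" using assms by blast
qed

lemma cmod_cdot_le_numerical_radius_unit:
  assumes "norm u = 1"
  shows "cmod (cdot u (A *v u)) \<le> numerical_radius A"
  unfolding numerical_radius_def
proof (rule cSup_upper)
  show "cmod (cdot u (A *v u)) \<in> {cmod \<mu> |\<mu>. \<mu> \<in> numerical_range A}"
    using assms by (auto simp: numerical_range_def cdot_self_eq_1)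
qed (rule numerical_range_bdd_above)

lemma of_real_scale: "of_real c *s u = c *\<^sub>R (u :: complex ^ 'k)"
  unfolding vec_eq_iff by (simp add: scaleR_conv_of_real[where 'a = complex])

lemma cmod_cdot_le_numerical_radius:
  "cmod (cdot u (A *v u)) \<le> numerical_radius A * (norm u)\<^sup>2"
proof (cases "u = 0")
  case False
  define v where "v = of_real (1 / norm u) *s u"
  have "norm v = 1"
    using False by (simp only: v_def of_real_scale norm_scaleR) simp
  have "u = of_real (norm u) *s v"
    using False by (simp add: v_def vec_eq_iff)
  then have "cdot u (A *v u) = cdot (of_real (norm u) *s v) (A *v (of_real (norm u) *s v))"
    by simp
  also have "\<dots> = of_real ((norm u)\<^sup>2) * cdot v (A *v v)"
    by (simp add: vector_scalar_commute cdot_scale_left cdot_scale_right power2_eq_square mult.assoc)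
  finally have "cmod (cdot u (A *v u)) = (norm u)\<^sup>2 * cmod (cdot v (A *v v))"
    by (simp add: norm_mult norm_power)
  also have "\<dots> \<le> (norm u)\<^sup>2 * numerical_radius A"
    by (rule mult_left_mono) (simp_all add: cmod_cdot_le_numerical_radius_unit \<open>norm v = 1\<close>)
  finally show ?thesis by (simp add: mult.commute)
qed simp

lemma numerical_radius_attained:
  obtains u where "norm u = 1" "cmod (cdot u (A *v u)) = numerical_radius A"
proof -
  let ?f = "\<lambda>u :: complex ^ 'a. cmod (cdot u (A *v u))"
  have "continuous_on (sphere 0 1) ?f"
    unfolding cdot_def matrix_vector_mult_def by (auto intro!: continuous_intros)
  moreover have "sphere (0 :: complex ^ 'a) 1 \<noteq> {}" by simp
  ultimately obtain u where u: "u \<in> sphere 0 1" "\<forall>v\<in>sphere 0 1. ?f v \<le> ?f u"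
    using continuous_attains_sup[OF compact_sphere] by blast
  then have "norm u = 1" by simp
  moreover have "numerical_radius A \<le> ?f u"
    by (rule numerical_radius_le) (use u in auto)
  ultimately show ?thesis
    using that cmod_cdot_le_numerical_radius_unit[of u A] by fastforce
qed

lemma numerical_radius_eqI:
  assumes "\<And>u. norm u = 1 \<Longrightarrow> \<exists>v. norm v = 1 \<and> cmod (cdot v (B *v v)) = cmod (cdot u (A *v u))"
    and "\<And>u. norm u = 1 \<Longrightarrow> \<exists>v. norm v = 1 \<and> cmod (cdot v (A *v v)) = cmod (cdot u (B *v u))"
  shows "numerical_radius A = numerical_radius B"
  by (metis assms antisym numerical_radius_le cmod_cdot_le_numerical_radius_unit)

lemma numerical_radius_unitary:
  assumes "unitary U"
  shows "numerical_radius (U ** A ** conj_transpose U) = numerical_radius A"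
proof (rule numerical_radius_eqI)
  fix u :: "complex ^ 'a" assume u: "norm u = 1"
  show "\<exists>v. norm v = 1 \<and> cmod (cdot v (A *v v)) = cmod (cdot u ((U ** A ** conj_transpose U) *v u))"
    using u by (metis assms cdot_conj_mult unitary_conj_transpose unitary_norm)
  have "conj_transpose U *v (U *v u) = u"
    by (simp add: matrix_vector_mul_assoc unitaryD[OF assms])
  then show "\<exists>v. norm v = 1 \<and> cmod (cdot v ((U ** A ** conj_transpose U) *v v)) = cmod (cdot u (A *v u))"
    using u by (metis assms cdot_conj_mult unitary_norm)
qed

lemma numerical_radius_scale:
  assumes "cmod c = 1"
  shows "numerical_radius (mat_scale c A) = numerical_radius A"
  by (rule numerical_radius_eqI)
    (auto simp: mat_scale_mult_vec cdot_scale_right norm_mult assms)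

lemma cdot_transpose: "cdot u (transpose A *v u) = cdot (conj_vec u) (A *v conj_vec u)"
proof -
  have "cdot u (transpose A *v u) = (\<Sum>i\<in>UNIV. \<Sum>j\<in>UNIV. cnj (u $ i) * A $ j $ i * u $ j)"
    by (simp add: cdot_def matrix_vector_mult_def sum_distrib_left mult.assoc)
  also have "\<dots> = (\<Sum>j\<in>UNIV. \<Sum>i\<in>UNIV. cnj (u $ i) * A $ j $ i * u $ j)"
    by (rule sum.swap)
  also have "\<dots> = cdot (conj_vec u) (A *v conj_vec u)"
    by (simp add: cdot_def matrix_vector_mult_def sum_distrib_left mult_ac conj_vec_def)
  finally show ?thesis .
qed

lemma norm_conj_vec: "norm (conj_vec u) = norm u"
  by (simp add: norm_vec_def conj_vec_def)

lemma numerical_radius_transpose: "numerical_radius (transpose A) = numerical_radius A"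
  by (rule numerical_radius_eqI)
    (metis cdot_transpose norm_conj_vec transpose_transpose)+

section \<open>Unitary matrices with a prescribed column\<close>

text \<open>The Householder reflection that exchanges \<open>axis i 1\<close> with \<open>-z\<close>, where \<open>z\<close> is the
  multiple of \<open>x\<close> by a phase whose \<open>i\<close>-th entry is nonnegative. Reflecting to \<open>-z\<close> and not
  to \<open>z\<close> keeps the normal vector \<open>z + axis i 1\<close> away from zero.\<close>

lemma unitary_with_column:
  fixes x :: "complex ^ 'k::finite"
  assumes "norm x = 1"
  obtains V where "unitary V" "V *v axis i 1 = x"
proof -
  define \<omega> where "\<omega> = (if x $ i = 0 then 1 else sgn (x $ i))"
  define z where "z = cnj \<omega> *s x"
  define r where "r = cmod (x $ i)"
  define v where "v = z + axis i 1"
  define s where "s = complex_of_real (1 / (1 + r))"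
  define H where "H = mat 1 - mat_scale s (outer v v)"
  have "1 + r \<noteq> 0"
    using norm_ge_zero[of "x $ i"] unfolding r_def by linarith
  then have s_r: "s * of_real (1 + r) = 1"
    unfolding s_def of_real_mult[symmetric] by simp
  have \<omega>: "cmod \<omega> = 1" by (simp add: \<omega>_def norm_sgn)
  have "cnj \<omega> * x $ i = of_real r"
  proof (cases "x $ i = 0")
    case False
    then have "x $ i = \<omega> * of_real r"
      by (simp add: \<omega>_def r_def sgn_eq)
    then show ?thesis
      by (simp add: cnj_mult_self \<omega> flip: mult.assoc)
  qed (simp add: r_def)
  then have zi: "z $ i = of_real r" by (simp add: z_def)
  have zz: "cdot z z = 1"
    using assms by (simp add: z_def cdot_scale_left cdot_scale_right cnj_mult_self \<omega> cdot_self_eq_1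
        flip: mult.assoc)
  have vv: "cdot v v = of_real (2 * (1 + r))"
    by (simp add: v_def cdot_add_left cdot_add_right cdot_axis zz zi axis_nth)
  have OO: "outer v v ** outer v v = mat_scale (cdot v v) (outer v v)"
    by (simp add: vec_eq_iff matrix_matrix_mult_def cdot_def sum_distrib_left sum_distrib_right mult_ac)
  have "conj_transpose H = H"
    by (auto simp: vec_eq_iff H_def s_def mat_def mult_ac)
  moreover have "H ** H = mat 1"
  proof -
    let ?O = "outer v v"
    have "H ** H = mat 1 - mat_scale s ?O - mat_scale s ?O + mat_scale s (mat_scale s (?O ** ?O))"
      by (simp add: H_def mat_mult_diff_left mat_mult_diff_right mat_scale_mult_left
          mat_scale_mult_right vec_eq_iff algebra_simps)
    also have "\<dots> = mat 1 - mat_scale (s + s - s * s * cdot v v) ?O"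
      by (simp add: vec_eq_iff OO algebra_simps)
    also have "s + s - s * s * cdot v v = 0"
    proof -
      have "s * s * cdot v v = 2 * s * (s * of_real (1 + r))"
        unfolding vv of_real_mult by simp
      then show ?thesis by (simp add: s_r del: of_real_add)
    qed
    also have "mat 1 - mat_scale 0 ?O = mat 1"
      by (simp add: vec_eq_iff)
    finally show ?thesis .
  qed
  ultimately have "unitary H"
    by (simp add: unitary_def)
  then have "unitary (mat_scale (- \<omega>) H)"
    by (simp add: unitary_scale \<omega>)
  moreover have "H *v axis i 1 = axis i 1 - v"
  proof -
    have "cdot v (axis i 1) = of_real (1 + r)"
      by (simp add: cdot_axis v_def zi axis_nth)
    then have "s * cdot v (axis i 1) = 1"
      by (simp only: s_r)
    then show ?thesis
      by (simp add: H_def matrix_vector_mult_diff_rdistrib mat_scale_mult_vec outer_mult_vec)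
  qed
  then have "mat_scale (- \<omega>) H *v axis i 1 = x"
    by (simp add: mat_scale_mult_vec v_def z_def \<omega> cnj_mult_self)
  ultimately show ?thesis using that by blast
qed

section \<open>Transposing a two-dimensional factor\<close>

text \<open>The equation says that the quadratic form of the traceless matrix with rows \<open>(p, q)\<close>
  and \<open>(r, -p)\<close> vanishes at the vector \<open>(1, z)\<close>. After division by \<open>p\<close>, the phase \<open>\<omega>\<close> of \<open>z\<close>
  is chosen to make the linear terms real; the modulus \<open>\<rho>\<close> is then the positive root of
  \<open>\<rho>\<^sup>2 = t \<rho> + 1\<close>.\<close>

lemma balancing_number:
  fixes p q r :: complex
  obtains z where "p * (1 - of_real ((cmod z)\<^sup>2)) + z * q + cnj z * r = 0"
proof (cases "p = 0")
  case True
  then show ?thesis using that[of 0] by simp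
next
  case False
  define d where "d = q / p - cnj (r / p)"
  define \<omega> where "\<omega> = (if d = 0 then 1 else cnj (sgn d))"
  define t where "t = Re (\<omega> * (q / p) + cnj \<omega> * (r / p))"
  define \<rho> where "\<rho> = (t + sqrt (t\<^sup>2 + 4)) / 2"
  have \<omega>: "cmod \<omega> = 1" by (simp add: \<omega>_def norm_sgn)
  have "\<omega> * d = of_real (cmod d)"
    by (simp add: \<omega>_def sgn_eq complex_norm_square[symmetric, unfolded power2_eq_square]
        mult.commute[of "cnj d"])
  then have "Im (\<omega> * d) = 0" by simp
  then have "Im (\<omega> * d + (w + cnj w)) = 0" for w
    by simp
  moreover have "\<omega> * (q / p) + cnj \<omega> * (r / p)
      = \<omega> * d + (cnj \<omega> * (r / p) + cnj (cnj \<omega> * (r / p)))"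
    by (simp add: d_def algebra_simps)
  ultimately have "Im (\<omega> * (q / p) + cnj \<omega> * (r / p)) = 0"
    by metis
  then have t: "\<omega> * (q / p) + cnj \<omega> * (r / p) = of_real t"
    by (simp add: t_def complex_eq_iff)
  have "(sqrt (t\<^sup>2 + 4))\<^sup>2 = t\<^sup>2 + 4"
    by (simp add: add_nonneg_pos)
  then have \<rho>: "1 - \<rho>\<^sup>2 + \<rho> * t = 0"
    by (simp add: \<rho>_def power2_eq_square field_simps)
  have "p * (1 - of_real ((cmod (of_real \<rho> * \<omega>))\<^sup>2)) + of_real \<rho> * \<omega> * q + cnj (of_real \<rho> * \<omega>) * r
      = p * ((1 - of_real (\<rho>\<^sup>2)) + of_real \<rho> * (\<omega> * (q / p) + cnj \<omega> * (r / p)))"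
    using False by (simp add: norm_mult \<omega> power_mult_distrib field_simps)
  also have "\<dots> = p * of_real (1 - \<rho>\<^sup>2 + \<rho> * t)"
    unfolding t by simp
  also have "\<dots> = 0"
    by (simp add: \<rho>)
  finally show ?thesis using that by blast
qed

text \<open>A two-dimensional instance of the convexity of the numerical range, obtained by
  applying the preceding lemma to the traceless part of \<open>B\<close>.\<close>

lemma half_trace_in_numerical_range_2:
  fixes B :: "'k::finite cmat"
  assumes univ: "UNIV = {i, k}" "i \<noteq> k"
  obtains u where "norm u = 1" "cdot u (B *v u) = (B $ i $ i + B $ k $ k) / 2"
proof -
  obtain z where z: "(B $ i $ i - B $ k $ k) / 2 * (1 - of_real ((cmod z)\<^sup>2))
      + z * B $ i $ k + cnj z * B $ k $ i = 0"
    using balancing_number by blast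
  define v :: "complex ^ 'k" where "v = (\<chi> a. if a = i then 1 else z)"
  have v: "v $ i = 1" "v $ k = z" using univ by (auto simp: v_def)
  have sum: "sum f UNIV = f i + f k" for f :: "'k \<Rightarrow> complex"
    unfolding univ(1) using univ(2) by simp
  have "cdot v v = 1 + of_real ((cmod z)\<^sup>2)"
    by (simp add: cdot_def sum v mult.commute[of "cnj z"] complex_norm_square del: of_real_power)
  then have norm: "of_real ((norm v)\<^sup>2) = 1 + complex_of_real ((cmod z)\<^sup>2)"
    by (simp only: cdot_self)
  have "cdot v (B *v v) = B $ i $ i + z * B $ i $ k + cnj z * B $ k $ i + z * cnj z * B $ k $ k"
    by (simp add: cdot_def matrix_vector_mult_def sum v algebra_simps)
  also have "\<dots> = (1 + z * cnj z) * ((B $ i $ i + B $ k $ k) / 2)"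
    using z unfolding complex_norm_square by (simp add: field_simps)
  also have "\<dots> = of_real ((norm v)\<^sup>2) * ((B $ i $ i + B $ k $ k) / 2)"
    unfolding norm complex_norm_square ..
  finally have form: "cdot v (B *v v) = of_real ((norm v)\<^sup>2) * ((B $ i $ i + B $ k $ k) / 2)" .
  have "v \<noteq> 0" using v(1) by auto
  define u where "u = of_real (1 / norm v) *s v"
  have "norm u = 1"
    using \<open>v \<noteq> 0\<close> by (simp only: u_def of_real_scale norm_scaleR) simp
  moreover have "cdot u (B *v u) = (B $ i $ i + B $ k $ k) / 2"
    using \<open>v \<noteq> 0\<close>
    by (simp add: u_def vector_scalar_commute cdot_scale_left cdot_scale_right form power2_eq_square)
  ultimately show ?thesis using that by blast
qed

lemma trace_unitary_conj:
  "unitary V \<Longrightarrow> trace (conj_transpose V ** B ** V) = trace B"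
  by (subst trace_mul_sym) (simp add: matrix_mul_assoc unitaryD)

text \<open>In an orthonormal basis in which both diagonal entries of \<open>B\<close> are half the trace,
  exchanging the two basis vectors is the same as transposing. The similarity depends on
  \<open>B\<close>, which is why it acts on one Kronecker product at a time and not on all matrices of
  the full size.\<close>

lemma transpose_unitarily_similar_2:
  fixes B :: "'k::finite cmat"
  assumes "CARD('k) = 2"
  obtains W where "unitary W" "transpose B = W ** B ** conj_transpose W"
proof -
  obtain i k :: 'k where univ: "UNIV = {i, k}" "i \<noteq> k"
    using assms by (metis card_2_iff)
  have sum: "sum f UNIV = f i + f k" for f :: "'k \<Rightarrow> complex"
    unfolding univ(1) using univ(2) by simp
  have all: "(\<forall>a. P a) \<longleftrightarrow> P i \<and> P k" for P :: "'k \<Rightarrow> bool"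
    using univ by (metis UNIV_I insertE singletonD)
  obtain u where u: "norm u = 1" "cdot u (B *v u) = (B $ i $ i + B $ k $ k) / 2"
    using half_trace_in_numerical_range_2[OF univ] by blast
  obtain V where V: "unitary V" "V *v axis i 1 = u"
    using unitary_with_column[OF u(1)] by blast
  define C where "C = conj_transpose V ** B ** V"
  define S :: "'k cmat" where "S = (\<chi> a b. if a = b then 0 else 1)"
  define V' where "V' = transpose (conj_transpose V)"
  have "cdot (axis i 1) (C *v axis i 1) = cdot u (B *v u)"
    unfolding C_def by (simp add: cdot_adjoint' V flip: matrix_vector_mul_assoc)
  moreover have "cdot (axis i 1) (C *v axis i 1) = C $ i $ i"
    by (simp add: cdot_def matrix_vector_mult_def axis_nth sum univ(2) univ(2)[symmetric])
  ultimately have "C $ i $ i = (B $ i $ i + B $ k $ k) / 2"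
    by (simp add: u)
  moreover have "C $ i $ i + C $ k $ k = B $ i $ i + B $ k $ k"
    using trace_unitary_conj[OF V(1), of B] by (simp add: trace_def sum C_def)
  ultimately have "C $ k $ k = C $ i $ i"
    by simp (metis add_left_cancel mult_2_right)
  then have CS: "transpose C = S ** C ** S"
    using univ by (simp add: vec_eq_iff all matrix_matrix_mult_def sum S_def)
  have S: "conj_transpose S = S"
    by (auto simp: vec_eq_iff S_def)
  moreover have "S ** S = mat 1"
    using univ by (simp add: vec_eq_iff all matrix_matrix_mult_def sum S_def mat_def)
  ultimately have "unitary S"
    by (simp add: unitary_def)
  have "unitary V'"
  proof (rule unitaryI)
    have "conj_transpose V' ** V' = transpose (conj_transpose V ** V)"
      by (simp add: V'_def vec_eq_iff matrix_matrix_mult_def mult.commute)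
    then show "conj_transpose V' ** V' = mat 1"
      by (simp only: V unitaryD transpose_mat)
  qed
  have V'_adj: "transpose V = conj_transpose V'"
    by (simp add: vec_eq_iff V'_def)
  let ?W = "V' ** S ** conj_transpose V"
  have "B = V ** C ** conj_transpose V"
    unfolding C_def by (simp only: unitary_conj_cancel V)
  then have "transpose B = V' ** transpose C ** conj_transpose V'"
    by (simp only: matrix_transpose_mul V'_def[symmetric] V'_adj matrix_mul_assoc)
  also have "\<dots> = V' ** S ** (conj_transpose V ** B ** V) ** S ** conj_transpose V'"
    unfolding CS unfolding C_def by (simp only: matrix_mul_assoc)
  also have "\<dots> = ?W ** B ** conj_transpose ?W"
    by (simp only: conj_transpose_mult conj_transpose_conj_transpose S matrix_mul_assoc)
  finally show ?thesis
    using that[of ?W] V(1) \<open>unitary S\<close> \<open>unitary V'\<close>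
    by (simp only: unitary_mult unitary_conj_transpose)
qed

lemma numerical_radius_transpose_right:
  fixes A :: "'m::finite cmat" and B :: "'n::finite cmat"
  assumes "CARD('n) = 2"
  shows "numerical_radius (A \<otimes> transpose B) = numerical_radius (A \<otimes> B)"
proof -
  obtain W where W: "unitary W" "transpose B = W ** B ** conj_transpose W"
    using transpose_unitarily_similar_2[OF assms] by blast
  have "A \<otimes> transpose B = (mat 1 \<otimes> W) ** (A \<otimes> B) ** conj_transpose (mat 1 \<otimes> W)"
    by (simp add: W conj_transpose_kronecker kronecker_mult)
  then show ?thesis
    by (simp add: numerical_radius_unitary unitary_kronecker unitary_one W)
qed

lemma numerical_radius_transpose_left:
  fixes A :: "'m::finite cmat" and B :: "'n::finite cmat"
  assumes "CARD('m) = 2"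
  shows "numerical_radius (transpose A \<otimes> B) = numerical_radius (A \<otimes> B)"
proof -
  obtain W where W: "unitary W" "transpose A = W ** A ** conj_transpose W"
    using transpose_unitarily_similar_2[OF assms] by blast
  have "transpose A \<otimes> B = (W \<otimes> mat 1) ** (A \<otimes> B) ** conj_transpose (W \<otimes> mat 1)"
    by (simp add: W conj_transpose_kronecker kronecker_mult)
  then show ?thesis
    by (simp add: numerical_radius_unitary unitary_kronecker unitary_one W)
qed

section \<open>Partial transposition changes the numerical radius from dimension three on\<close>

lemma mat_unit_kronecker: "mat_unit i k \<otimes> mat_unit j l = mat_unit (i, j) (k, l)"
  by (auto simp: vec_eq_iff)

lemma cdot_mat_unit: "cdot u (mat_unit p q *v u) = cnj (u $ p) * u $ q"
proof -
  have "mat_unit p q *v u = u $ q *s axis p 1"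
    by (simp add: vec_eq_iff matrix_vector_mult_def axis_nth if_distrib if_distribR cong: if_cong)
  then show ?thesis
    by (simp add: cdot_scale_right) (simp add: cdot_def axis_nth if_distrib if_distribR cong: if_cong)
qed

text \<open>A Kronecker product of two weighted shifts is a sum of weighted edges between index
  pairs: in \<open>S \<otimes> S\<close> the edge of weight 4 is continued by the edge of weight 1, while
  transposing the second factor isolates it.\<close>

definition weighted_shift :: "'k \<Rightarrow> 'k \<Rightarrow> 'k \<Rightarrow> complex ^ 'k ^ 'k"
  where "weighted_shift i k l = mat_unit i k + mat_scale 2 (mat_unit k l)"

lemma transpose_add: "transpose (A + B) = transpose A + transpose (B :: complex ^ 'b ^ 'a)"
  by (simp add: vec_eq_iff)

lemma transpose_scale: "transpose (mat_scale c A) = mat_scale c (transpose A)"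
  by (simp add: vec_eq_iff)

lemma transpose_mat_unit: "transpose (mat_unit i k) = mat_unit k i"
  by (auto simp: vec_eq_iff)

text \<open>The heavy path runs through \<open>(i1, j1)\<close>, \<open>(i2, j2)\<close>, \<open>(i3, j3)\<close>, and the entries 1, 4,
  4 approximate its extremal vector: the quotient \<open>68 / 33\<close> already exceeds 2.\<close>

lemma numerical_radius_shift_kronecker:
  fixes i1 :: "'m::finite" and j1 :: "'n::finite"
  assumes "distinct [i1, i2, i3]" "distinct [j1, j2, j3]"
  shows "2 < numerical_radius (weighted_shift i1 i2 i3 \<otimes> weighted_shift j1 j2 j3)"
proof -
  define u :: "complex ^ ('m \<times> 'n)" where
    "u = (\<chi> p. if p = (i1, j1) then 1 else if p = (i2, j2) then 4 else if p = (i3, j3) then 4 else 0)"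
  let ?X = "weighted_shift i1 i2 i3 \<otimes> weighted_shift j1 j2 j3"
  have ne: "i1 \<noteq> i2" "i1 \<noteq> i3" "i2 \<noteq> i3" "j1 \<noteq> j2" "j1 \<noteq> j3" "j2 \<noteq> j3"
    using assms by auto
  have "cdot u (?X *v u) = 68"
    by (simp add: weighted_shift_def kronecker_linear mat_unit_kronecker matrix_vector_mult_add_rdistrib
        mat_scale_mult_vec cdot_add_right cdot_scale_right cdot_mat_unit u_def ne ne[symmetric])
  moreover have "(norm u)\<^sup>2 = 33"
  proof -
    have "(norm u)\<^sup>2 = (\<Sum>p\<in>{(i1, j1), (i2, j2), (i3, j3)}. (cmod (u $ p))\<^sup>2)"
      unfolding norm_square_sum by (rule sum.mono_neutral_right) (auto simp: u_def)
    also have "\<dots> = 33"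
      by (simp add: u_def ne ne[symmetric])
    finally show ?thesis .
  qed
  ultimately show ?thesis
    using cmod_cdot_le_numerical_radius[of u ?X] by simp
qed

lemma weighted_products_le_squares:
  fixes a b c d e f g :: real
  shows "a * b + 2 * (c * d) + 2 * (d * e) + 4 * (f * g)
    \<le> 2 * (a\<^sup>2 + b\<^sup>2 + c\<^sup>2 + d\<^sup>2 + e\<^sup>2 + f\<^sup>2 + g\<^sup>2)"
proof -
  have h1: "a * b \<le> 2 * a\<^sup>2 + 2 * b\<^sup>2"
    using sum_squares_bound[of a b] zero_le_power2[of a] zero_le_power2[of b] unfolding mult.assoc by linarith
  have h2: "2 * (c * d) \<le> 2 * c\<^sup>2 + d\<^sup>2" "2 * (d * e) \<le> d\<^sup>2 + 2 * e\<^sup>2"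
    using sum_squares_bound[of c d] sum_squares_bound[of d e] zero_le_power2[of c] zero_le_power2[of e] unfolding mult.assoc by linarith+
  have h3: "4 * (f * g) \<le> 2 * f\<^sup>2 + 2 * g\<^sup>2"
    using sum_squares_bound[of f g] unfolding mult.assoc by linarith
  show ?thesis using add_mono[OF add_mono[OF h1 h2(1)] add_mono[OF h2(2) h3]] by (simp only: distrib_left)
qed

text \<open>After the transposition the edge of weight 4 is isolated, the two edges of weight 2
  form a path, and the edge of weight 1 is isolated; each of these blocks has numerical
  radius at most 2.\<close>

lemma numerical_radius_shift_kronecker_transpose:
  fixes i1 :: "'m::finite" and j1 :: "'n::finite"
  assumes "distinct [i1, i2, i3]" "distinct [j1, j2, j3]"
  shows "numerical_radius (weighted_shift i1 i2 i3 \<otimes> transpose (weighted_shift j1 j2 j3)) \<le> 2"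
proof (rule numerical_radius_le)
  fix u :: "complex ^ ('m \<times> 'n)" assume u: "norm u = 1"
  let ?X = "weighted_shift i1 i2 i3 \<otimes> transpose (weighted_shift j1 j2 j3)"
  have ne: "i1 \<noteq> i2" "i1 \<noteq> i3" "i2 \<noteq> i3" "j1 \<noteq> j2" "j1 \<noteq> j3" "j2 \<noteq> j3"
    using assms by auto
  let ?n = "\<lambda>i j. cmod (u $ (i, j))"
  let ?S = "{(i1, j2), (i2, j1), (i1, j3), (i2, j2), (i3, j1), (i2, j3), (i3, j2)}"
  have "(\<Sum>p\<in>?S. (cmod (u $ p))\<^sup>2) \<le> (norm u)\<^sup>2"
    unfolding norm_square_sum by (rule sum_mono2) auto
  then have S: "(?n i1 j2)\<^sup>2 + (?n i2 j1)\<^sup>2 + (?n i1 j3)\<^sup>2 + (?n i2 j2)\<^sup>2 + (?n i3 j1)\<^sup>2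
      + (?n i2 j3)\<^sup>2 + (?n i3 j2)\<^sup>2 \<le> 1"
    by (simp add: u ne ne[symmetric] add.assoc)
  have "cdot u (?X *v u) = cnj (u $ (i1, j2)) * u $ (i2, j1) + 2 * (cnj (u $ (i1, j3)) * u $ (i2, j2))
      + 2 * (cnj (u $ (i2, j2)) * u $ (i3, j1)) + 4 * (cnj (u $ (i2, j3)) * u $ (i3, j2))"
    by (simp add: weighted_shift_def transpose_add transpose_scale transpose_mat_unit kronecker_linear
        mat_unit_kronecker matrix_vector_mult_add_rdistrib mat_scale_mult_vec cdot_add_right
        cdot_scale_right cdot_mat_unit)
  also have "cmod \<dots> \<le> ?n i1 j2 * ?n i2 j1 + 2 * (?n i1 j3 * ?n i2 j2)
      + 2 * (?n i2 j2 * ?n i3 j1) + 4 * (?n i2 j3 * ?n i3 j2)"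
    by (intro norm_triangle_mono) (simp_all add: norm_mult)
  also have "\<dots> \<le> 2 * ((?n i1 j2)\<^sup>2 + (?n i2 j1)\<^sup>2 + (?n i1 j3)\<^sup>2 + (?n i2 j2)\<^sup>2 + (?n i3 j1)\<^sup>2
      + (?n i2 j3)\<^sup>2 + (?n i3 j2)\<^sup>2)"
    by (rule weighted_products_le_squares)
  also have "\<dots> \<le> 2" using S by simp
  finally show "cmod (cdot u (?X *v u)) \<le> 2" .
qed

lemma obtain_three:
  assumes "CARD('k::finite) \<ge> 3"
  obtains a b c :: "'k::finite" where "distinct [a, b, c]"
proof -
  obtain S :: "'k set" where "card S = 3"
    using assms obtain_subset_with_card_n by metis
  then show ?thesis
    using that by (auto simp: card_3_iff)
qed

lemma partial_transpose_not_radius_preserving: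
  assumes "CARD('m::finite) \<ge> 3" "CARD('n::finite) \<ge> 3"
  obtains A :: "'m::finite cmat" and B :: "'n::finite cmat"
    where "numerical_radius (A \<otimes> transpose B) < numerical_radius (A \<otimes> B)"
proof -
  obtain i1 i2 i3 :: 'm where "distinct [i1, i2, i3]" by (rule obtain_three[OF assms(1)])
  moreover obtain j1 j2 j3 :: 'n where "distinct [j1, j2, j3]" by (rule obtain_three[OF assms(2)])
  ultimately show ?thesis
    using numerical_radius_shift_kronecker numerical_radius_shift_kronecker_transpose that
    by (meson le_less_trans)
qed

section \<open>Contact vectors of the numerical radius\<close>

lemma linear_coefficient_zero:
  fixes a b :: real
  assumes "\<And>s. 0 \<le> s * a + s\<^sup>2 * b"
  shows "a = 0"
proof (rule ccontr)
  assume "a \<noteq> 0"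
  define k where "k = \<bar>b\<bar> + 1"
  have k: "k > 0" "b < k" by (simp_all add: k_def)
  have "0 \<le> (- a / k) * a + (- a / k)\<^sup>2 * b" by (rule assms)
  also have "\<dots> = a\<^sup>2 * (b - k) / k\<^sup>2"
    using k by (simp add: power2_eq_square field_simps)
  finally have "0 \<le> a\<^sup>2 * (b - k)"
    using k by (simp add: zero_le_divide_iff)
  moreover have "a\<^sup>2 * (b - k) < 0"
    using k \<open>a \<noteq> 0\<close> by (simp add: mult_pos_neg)
  ultimately show False by simp
qed

text \<open>A contact vector, that is, a unit vector at which the bound
  \<open>Re (cdot v (T *v v)) \<le> (norm v)\<^sup>2\<close> is an equality, is a critical point of the difference,
  hence an eigenvector of the Hermitian part of \<open>T\<close>. The variation is taken in the direction
  of the defect \<open>g\<close> itself.\<close>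

lemma contact_vector_eigen:
  assumes w: "numerical_radius T \<le> 1" and u: "norm u = 1" "cdot u (T *v u) = 1"
  shows "T *v u + conj_transpose T *v u = u + u"
proof -
  define g where "g = u + u - (T *v u + conj_transpose T *v u)"
  have uu: "cdot u u = 1" by (simp add: cdot_self_eq_1 u)
  have Re_comm: "Re (cdot a b) = Re (cdot b a)" for a b :: "complex ^ 'a"
    by (subst cdot_commute) simp
  have "0 \<le> s * Re (cdot g g) + s\<^sup>2 * (Re (cdot g g) - Re (cdot g (T *v g)))" for s
  proof -
    define v where "v = u + of_real s *s g"
    have "Re (cdot v (T *v v)) \<le> numerical_radius T * (norm v)\<^sup>2"
      using cmod_cdot_le_numerical_radius complex_Re_le_cmod order_trans by blast
    also have "\<dots> \<le> (norm v)\<^sup>2"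
      using mult_right_mono[OF w, of "(norm v)\<^sup>2"] by simp
    also have "\<dots> = Re (cdot v v)"
      by (simp add: cdot_self)
    finally have le: "Re (cdot v (T *v v)) \<le> Re (cdot v v)" .
    have vv: "Re (cdot v v) = 1 + s * (2 * Re (cdot g u)) + s\<^sup>2 * Re (cdot g g)"
      using Re_comm[of u g]
      by (simp add: v_def cdot_add_left cdot_add_right cdot_scale_left cdot_scale_right uu
          power2_eq_square algebra_simps)
    have "Re (cdot u (T *v g)) = Re (cdot g (conj_transpose T *v u))"
      by (subst cdot_adjoint) (rule Re_comm)
    then have vTv: "Re (cdot v (T *v v)) = 1 + s * Re (cdot g (T *v u + conj_transpose T *v u))
        + s\<^sup>2 * Re (cdot g (T *v g))"
      by (simp add: v_def matrix_vector_right_distrib vector_scalar_commute cdot_add_left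
          cdot_add_right cdot_scale_left cdot_scale_right u power2_eq_square algebra_simps)
    have "Re (cdot g g) = 2 * Re (cdot g u) - Re (cdot g (T *v u + conj_transpose T *v u))"
      unfolding g_def[THEN arg_cong, of "cdot g"] cdot_diff_right cdot_add_right by simp
    then have "s * Re (cdot g g)
        = s * (2 * Re (cdot g u)) - s * Re (cdot g (T *v u + conj_transpose T *v u))"
      by (simp only: right_diff_distrib)
    moreover have "s\<^sup>2 * (Re (cdot g g) - Re (cdot g (T *v g)))
        = s\<^sup>2 * Re (cdot g g) - s\<^sup>2 * Re (cdot g (T *v g))"
      by (simp only: right_diff_distrib)
    ultimately show ?thesis
      using le unfolding vv vTv by linarith
  qed
  then have "Re (cdot g g) = 0"
    by (rule linear_coefficient_zero)
  then have "g = 0" by (simp add: cdot_self)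
  then show ?thesis by (simp add: g_def)
qed

text \<open>The values \<open>\<xi> + a c\<close> of all the forms \<open>X + a Y\<close> at \<open>u\<close> lie in the unit disc, and their
  centre \<open>\<xi>\<close> has modulus 1, so \<open>c = 0\<close> and \<open>u\<close> is a contact vector of every \<open>X + a Y\<close>. The
  eigenvector equation then holds for all phases \<open>a\<close>, and comparing its terms in \<open>a\<close> and
  \<open>cnj a\<close> annihilates both.\<close>

lemma contact_vector_kernel:
  assumes w: "\<And>a. cmod a = 1 \<Longrightarrow> numerical_radius (X + mat_scale a Y) \<le> 1"
    and u: "norm u = 1" "cmod (cdot u (X *v u)) = 1"
  shows "Y *v u = 0" "conj_transpose Y *v u = 0"
proof -
  define \<xi> where "\<xi> = cdot u (X *v u)"
  define c where "c = cdot u (Y *v u)"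
  have \<xi>: "cmod \<xi> = 1" by (simp add: \<xi>_def u)
  have val: "cdot u ((X + mat_scale a Y) *v u) = \<xi> + a * c" for a
    by (simp add: \<xi>_def c_def matrix_vector_mult_add_rdistrib mat_scale_mult_vec cdot_add_right
        cdot_scale_right)
  have le: "cmod (\<xi> + a * c) \<le> 1" if "cmod a = 1" for a
    using w[OF that] cmod_cdot_le_numerical_radius_unit[OF u(1), of "X + mat_scale a Y"]
    by (simp add: val)
  have "(cmod (\<xi> + c))\<^sup>2 \<le> 1" "(cmod (\<xi> - c))\<^sup>2 \<le> 1"
    using le[of 1] le[of "- 1"] by (simp_all add: power_le_one)
  moreover have "(cmod (\<xi> + c))\<^sup>2 + (cmod (\<xi> - c))\<^sup>2 = 2 * (cmod \<xi>)\<^sup>2 + 2 * (cmod c)\<^sup>2"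
    unfolding cmod_power2 by (simp add: power2_eq_square algebra_simps)
  ultimately have "(cmod c)\<^sup>2 \<le> 0" unfolding \<xi> one_power2 by linarith
  then have "c = 0" by simp
  let ?P = "cnj \<xi> *s (Y *v u)" and ?Q = "\<xi> *s (conj_transpose Y *v u)"
  define K where "K = cnj \<xi> *s (X *v u) + \<xi> *s (conj_transpose X *v u)"
  have eq: "K + (a *s ?P + cnj a *s ?Q) = u + u" if a: "cmod a = 1" for a
  proof -
    let ?T = "mat_scale (cnj \<xi>) (X + mat_scale a Y)"
    have "numerical_radius ?T \<le> 1"
      using w[OF a] by (simp add: numerical_radius_scale \<xi>)
    moreover have "cdot u (?T *v u) = 1"
      by (simp add: mat_scale_mult_vec cdot_scale_right val \<open>c = 0\<close> cnj_mult_self \<xi>)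
    ultimately have "?T *v u + conj_transpose ?T *v u = u + u"
      by (rule contact_vector_eigen[OF _ u(1)])
    then show ?thesis
      by (simp add: K_def mat_scale_mult_vec conj_transpose_scale conj_transpose_add
          matrix_vector_mult_add_rdistrib vec_eq_iff algebra_simps)
  qed
  have "?P $ i = 0 \<and> ?Q $ i = 0" for i
  proof -
    have e: "K $ i + (a * ?P $ i + cnj a * ?Q $ i) = u $ i + u $ i" if "cmod a = 1" for a
      using eq[OF that] by (simp add: vec_eq_iff mult.assoc)
    have zero: "z = 0" if "k + z = t" "k - z = t" for k z t :: complex
    proof -
      have "2 * z = (k + z) - (k - z)" by simp
      also have "\<dots> = 0" unfolding that by simp
      finally show ?thesis by simp
    qed
    have "?P $ i + ?Q $ i = 0"
      by (rule zero[of "K $ i" _ "u $ i + u $ i"])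
        (use e[of 1] e[of "-1"] in \<open>simp_all add: algebra_simps\<close>)
    moreover have "\<i> * (?P $ i - ?Q $ i) = 0"
      by (rule zero[of "K $ i" _ "u $ i + u $ i"])
        (use e[of \<i>] e[of "-\<i>"] in \<open>simp_all add: algebra_simps\<close>)
    ultimately show ?thesis by simp
  qed
  then have "cnj \<xi> *s (Y *v u) = 0" "\<xi> *s (conj_transpose Y *v u) = 0"
    by (simp_all only: vec_eq_iff zero_index) auto
  moreover have "\<xi> \<noteq> 0" using \<xi> by auto
  ultimately show "Y *v u = 0" "conj_transpose Y *v u = 0"
    by (simp_all add: vec_eq_iff)
qed

section \<open>Linear maps preserving the numerical radius of Kronecker products\<close>

definition radius_preserving :: "(('m::finite \<times> 'n::finite) cmat \<Rightarrow> ('m \<times> 'n) cmat) \<Rightarrow> bool"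
  where "radius_preserving \<phi> \<longleftrightarrow> complex_linear \<phi> \<and>
    (\<forall>(A :: 'm cmat) (B :: 'n cmat). numerical_radius (\<phi> (A \<otimes> B)) = numerical_radius (A \<otimes> B))"

lemma complex_linear_add: "complex_linear \<phi> \<Longrightarrow> \<phi> (X + Y) = \<phi> X + \<phi> Y"
  and complex_linear_scale: "complex_linear \<phi> \<Longrightarrow> \<phi> (mat_scale c X) = mat_scale c (\<phi> X)"
  by (simp_all add: complex_linear_iff)

lemma complex_linear_zero: "complex_linear \<phi> \<Longrightarrow> \<phi> 0 = 0"
  using complex_linear_scale[of \<phi> 0 0] by simp

lemma complex_linear_sum: "complex_linear \<phi> \<Longrightarrow> \<phi> (sum f S) = (\<Sum>a\<in>S. \<phi> (f a))"
  by (induction S rule: infinite_finite_induct)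
    (simp_all add: complex_linear_zero complex_linear_add)

lemma complex_linear_conj:
  "complex_linear \<phi> \<Longrightarrow> complex_linear (\<lambda>X. C ** \<phi> (A ** X ** B) ** D)"
  by (simp add: complex_linear_iff matrix_add_ldistrib mat_add_mult_left mat_scale_mult_left
      mat_scale_mult_right)

lemma radius_preserving_conj:
  assumes \<phi>: "radius_preserving \<phi>" and V: "unitary V" and W: "unitary W"
  shows "radius_preserving (\<lambda>X. \<phi> ((V \<otimes> W) ** X ** conj_transpose (V \<otimes> W)))"
proof -
  have "complex_linear \<phi>" using \<phi> by (simp add: radius_preserving_def)
  from complex_linear_conj[OF this, of "mat 1" "V \<otimes> W" "conj_transpose (V \<otimes> W)" "mat 1"]
  have "complex_linear (\<lambda>X. \<phi> ((V \<otimes> W) ** X ** conj_transpose (V \<otimes> W)))"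
    by simp
  moreover have "numerical_radius (\<phi> ((V \<otimes> W) ** (A \<otimes> B) ** conj_transpose (V \<otimes> W)))
      = numerical_radius (A \<otimes> B)" for A B
  proof -
    have "numerical_radius (\<phi> ((V \<otimes> W) ** (A \<otimes> B) ** conj_transpose (V \<otimes> W)))
        = numerical_radius ((V \<otimes> W) ** (A \<otimes> B) ** conj_transpose (V \<otimes> W))"
      using \<phi> by (simp add: radius_preserving_def conj_transpose_kronecker kronecker_mult)
    also have "\<dots> = numerical_radius (A \<otimes> B)"
      by (simp add: numerical_radius_unitary unitary_kronecker V W)
    finally show ?thesis .
  qed
  ultimately show ?thesis
    by (simp add: radius_preserving_def)
qed

lemma numerical_radius_diag_mat_le:
  assumes "\<And>p. cmod (d p) \<le> 1"
  shows "numerical_radius (diag_mat d) \<le> 1"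
proof (rule numerical_radius_le)
  fix u :: "complex ^ 'a" assume u: "norm u = 1"
  have "diag_mat d *v u = (\<chi> p. d p * u $ p)"
    by (simp add: vec_eq_iff matrix_vector_mult_def if_distrib if_distribR cong: if_cong)
  then have "cmod (cdot u (diag_mat d *v u)) \<le> (\<Sum>p\<in>UNIV. cmod (cnj (u $ p) * (d p * u $ p)))"
    by (simp add: cdot_def norm_sum)
  also have "\<dots> \<le> (\<Sum>p\<in>UNIV. (cmod (u $ p))\<^sup>2)"
  proof (rule sum_mono)
    fix p
    show "cmod (cnj (u $ p) * (d p * u $ p)) \<le> (cmod (u $ p))\<^sup>2"
      using mult_right_mono[OF assms[of p], of "(cmod (u $ p))\<^sup>2"]
      by (simp add: norm_mult power2_eq_square mult_ac)
  qed
  also have "\<dots> = 1"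
    using u by (simp flip: norm_square_sum)
  finally show "cmod (cdot u (diag_mat d *v u)) \<le> 1" .
qed

lemma numerical_radius_mat_unit: "numerical_radius (mat_unit p p) = 1"
proof (rule antisym)
  have "mat_unit p p = diag_mat (\<lambda>a. if a = p then 1 else 0)"
    by (auto simp: vec_eq_iff)
  then show "numerical_radius (mat_unit p p) \<le> 1"
    by (simp add: numerical_radius_diag_mat_le)
  have "norm (axis p 1 :: complex ^ 'a) = 1" by simp
  from cmod_cdot_le_numerical_radius_unit[OF this, of "mat_unit p p"]
  show "1 \<le> numerical_radius (mat_unit p p)"
    by (simp add: cdot_mat_unit axis_nth)
qed

text \<open>A contact vector for the image of one diagonal matrix unit is in the kernel of the
  images of all the others. The others in the same row or column of the index grid are
  reached by perturbing one tensor factor; for the remaining ones both factors are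
  perturbed, using that the images of the grid neighbours already annihilate \<open>u\<close>.\<close>

lemma contact_vector_exists:
  fixes \<phi> :: "('m::finite \<times> 'n::finite) cmat \<Rightarrow> ('m \<times> 'n) cmat"
  assumes \<phi>: "radius_preserving \<phi>"
  obtains u where "norm u = 1" "cmod (cdot u (\<phi> (mat_unit p p) *v u)) = 1"
    "\<And>q. q \<noteq> p \<Longrightarrow> \<phi> (mat_unit q q) *v u = 0 \<and> conj_transpose (\<phi> (mat_unit q q)) *v u = 0"
proof -
  obtain i j where p: "p = (i, j)" by (cases p)
  have lin: "complex_linear \<phi>" using \<phi> by (simp add: radius_preserving_def)
  have nr: "numerical_radius (\<phi> (A \<otimes> B)) = numerical_radius (A \<otimes> B)" for A B
    using \<phi> by (simp add: radius_preserving_def)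
  let ?E = "\<lambda>i j. mat_unit (i, j) (i, j) :: ('m \<times> 'n) cmat"
  have "numerical_radius (\<phi> (?E i j)) = 1"
    unfolding mat_unit_kronecker[symmetric] nr
    by (simp add: mat_unit_kronecker numerical_radius_mat_unit)
  then obtain u where u: "norm u = 1" "cmod (cdot u (\<phi> (?E i j) *v u)) = 1"
    by (metis numerical_radius_attained)
  have row: "\<phi> (?E k j) *v u = 0 \<and> conj_transpose (\<phi> (?E k j)) *v u = 0" if "k \<noteq> i" for k
  proof -
    have "numerical_radius (\<phi> (?E i j) + mat_scale a (\<phi> (?E k j))) \<le> 1" if a: "cmod a = 1" for a
    proof -
      have "numerical_radius (\<phi> (?E i j) + mat_scale a (\<phi> (?E k j)))
          = numerical_radius ((mat_unit i i + mat_scale a (mat_unit k k)) \<otimes> mat_unit j j)"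
        unfolding nr[symmetric]
        by (simp add: kronecker_linear complex_linear_add complex_linear_scale lin mat_unit_kronecker)
      also have "(mat_unit i i + mat_scale a (mat_unit k k)) \<otimes> mat_unit j j
          = diag_mat (\<lambda>p. if p = (i, j) then 1 else if p = (k, j) then a else 0)"
        using \<open>k \<noteq> i\<close> by (auto simp: vec_eq_iff)
      also have "numerical_radius \<dots> \<le> 1"
        by (rule numerical_radius_diag_mat_le) (simp add: a)
      finally show ?thesis .
    qed
    then show ?thesis using contact_vector_kernel[OF _ u] by blast
  qed
  have column: "\<phi> (?E i l) *v u = 0 \<and> conj_transpose (\<phi> (?E i l)) *v u = 0" if "l \<noteq> j" for l
  proof -
    have "numerical_radius (\<phi> (?E i j) + mat_scale a (\<phi> (?E i l))) \<le> 1" if a: "cmod a = 1" for a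
    proof -
      have "numerical_radius (\<phi> (?E i j) + mat_scale a (\<phi> (?E i l)))
          = numerical_radius (mat_unit i i \<otimes> (mat_unit j j + mat_scale a (mat_unit l l)))"
        unfolding nr[symmetric]
        by (simp add: kronecker_linear complex_linear_add complex_linear_scale lin mat_unit_kronecker)
      also have "mat_unit i i \<otimes> (mat_unit j j + mat_scale a (mat_unit l l))
          = diag_mat (\<lambda>p. if p = (i, j) then 1 else if p = (i, l) then a else 0)"
        using \<open>l \<noteq> j\<close> by (auto simp: vec_eq_iff)
      also have "numerical_radius \<dots> \<le> 1"
        by (rule numerical_radius_diag_mat_le) (simp add: a)
      finally show ?thesis .
    qed
    then show ?thesis using contact_vector_kernel[OF _ u] by blast
  qed
  have corner: "\<phi> (?E k l) *v u = 0 \<and> conj_transpose (\<phi> (?E k l)) *v u = 0"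
    if "k \<noteq> i" "l \<noteq> j" for k l
  proof -
    let ?X = "\<phi> (?E i j) + \<phi> (?E k j)" and ?Y = "\<phi> (?E i l) + \<phi> (?E k l)"
    have "numerical_radius (?X + mat_scale a ?Y) \<le> 1" if a: "cmod a = 1" for a
    proof -
      have "?X + mat_scale a ?Y
          = \<phi> ((mat_unit i i + mat_unit k k) \<otimes> (mat_unit j j + mat_scale a (mat_unit l l)))"
        by (simp add: kronecker_linear complex_linear_add complex_linear_scale lin mat_unit_kronecker)
      then have "numerical_radius (?X + mat_scale a ?Y)
          = numerical_radius ((mat_unit i i + mat_unit k k) \<otimes> (mat_unit j j + mat_scale a (mat_unit l l)))"
        by (simp only: nr)
      also have "(mat_unit i i + mat_unit k k) \<otimes> (mat_unit j j + mat_scale a (mat_unit l l))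
          = diag_mat (\<lambda>p. (if fst p = i \<or> fst p = k then 1 else 0)
              * (if snd p = j then 1 else if snd p = l then a else 0))"
        using \<open>k \<noteq> i\<close> \<open>l \<noteq> j\<close> by (auto simp: vec_eq_iff prod_eq_iff)
      also have "numerical_radius \<dots> \<le> 1"
        by (rule numerical_radius_diag_mat_le) (simp add: a)
      finally show ?thesis .
    qed
    moreover have "cmod (cdot u (?X *v u)) = 1"
      using row[OF \<open>k \<noteq> i\<close>] u by (simp add: matrix_vector_mult_add_rdistrib)
    ultimately have "?Y *v u = 0 \<and> conj_transpose ?Y *v u = 0"
      using contact_vector_kernel[OF _ u(1), of ?X ?Y] by blast
    then show ?thesis
      using column[OF \<open>l \<noteq> j\<close>] by (simp add: matrix_vector_mult_add_rdistrib conj_transpose_add)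
  qed
  have "\<phi> (mat_unit q q) *v u = 0 \<and> conj_transpose (\<phi> (mat_unit q q)) *v u = 0" if "q \<noteq> p" for q
    using row[of "fst q"] column[of "snd q"] corner[of "fst q" "snd q"] that p
    by (cases q) (metis fst_conv snd_conv)
  with u show ?thesis using that p by blast
qed

text \<open>The entries of \<open>M\<close> in the basis of the columns of \<open>U\<close>; this is how a matrix is
  identified from its values on an orthonormal basis.\<close>

lemma conj_mult_nth:
  "(conj_transpose U ** M ** U) $ q $ r = cdot (U *v axis q 1) (M *v (U *v axis r 1))"
proof -
  have "(conj_transpose U ** M ** U) $ q $ r
      = cdot (axis q 1) ((conj_transpose U ** M ** U) *v axis r 1)"
    by (simp only: cdot_axis mult_axis_nth)
  also have "\<dots> = cdot (U *v axis q 1) (M *v (U *v axis r 1))"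
    by (simp add: cdot_adjoint' flip: matrix_vector_mul_assoc)
  finally show ?thesis .
qed

text \<open>The contact vectors of the diagonal matrix units form an orthonormal basis: pairing
  the eigenvector equation of \<open>u p\<close> with \<open>u q\<close> gives \<open>0 = 2 * cdot (u q) (u p)\<close>, because
  \<open>u q\<close> is annihilated by the image of the \<open>p\<close>-th unit and by its adjoint. In this basis the
  images are again diagonal units, up to phases.\<close>

lemma radius_preserving_mat_unit:
  fixes \<phi> :: "('m::finite \<times> 'n::finite) cmat \<Rightarrow> ('m \<times> 'n) cmat"
  assumes \<phi>: "radius_preserving \<phi>"
  obtains U \<xi> where "unitary U" "\<And>p. cmod (\<xi> p) = 1"
    "\<And>p. \<phi> (mat_unit p p) = mat_scale (\<xi> p) (U ** mat_unit p p ** conj_transpose U)"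
proof -
  define X where "X p = \<phi> (mat_unit p p)" for p
  have "\<forall>p. \<exists>u. norm u = 1 \<and> cmod (cdot u (X p *v u)) = 1 \<and>
      (\<forall>q. q \<noteq> p \<longrightarrow> X q *v u = 0 \<and> conj_transpose (X q) *v u = 0)"
    unfolding X_def using contact_vector_exists[OF \<phi>] by metis
  then obtain u where u: "\<And>p. norm (u p) = 1" "\<And>p. cmod (cdot (u p) (X p *v u p)) = 1"
    and ker: "\<And>p q. q \<noteq> p \<Longrightarrow> X q *v u p = 0" "\<And>p q. q \<noteq> p \<Longrightarrow> conj_transpose (X q) *v u p = 0"
    by metis
  define \<xi> where "\<xi> p = cdot (u p) (X p *v u p)" for p
  have \<xi>: "cmod (\<xi> p) = 1" for p by (simp add: \<xi>_def u)
  have orth: "cdot (u q) (u p) = (if q = p then 1 else 0)" for p q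
  proof (cases "q = p")
    case True
    then show ?thesis by (simp add: cdot_self_eq_1 u)
  next
    case False
    let ?T = "mat_scale (cnj (\<xi> p)) (X p)"
    have "numerical_radius ?T \<le> 1"
    proof -
      have "numerical_radius (X p) = 1"
        using \<phi> numerical_radius_mat_unit[of p]
        unfolding X_def radius_preserving_def
        by (metis mat_unit_kronecker surj_pair)
      then show ?thesis by (simp add: numerical_radius_scale \<xi>)
    qed
    moreover have "cdot (u p) (?T *v u p) = 1"
      by (simp add: mat_scale_mult_vec cdot_scale_right cnj_mult_self \<xi> flip: \<xi>_def)
    ultimately have "?T *v u p + conj_transpose ?T *v u p = u p + u p"
      by (rule contact_vector_eigen[OF _ u(1)])
    then have "cdot (u q) (u p + u p) = cdot (u q) (?T *v u p) + cdot (u q) (conj_transpose ?T *v u p)"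
      by (metis cdot_add_right)
    also have "\<dots> = 0"
      using False
      by (simp add: mat_scale_mult_vec conj_transpose_scale cdot_scale_right cdot_adjoint cdot_adjoint' ker)
    finally show ?thesis
      using False unfolding cdot_add_right by simp
  qed
  define U where "U = (\<chi> a p. u p $ a)"
  have col: "U *v axis p 1 = u p" for p
    by (simp add: vec_eq_iff mult_axis_nth U_def)
  have "unitary U"
  proof (rule unitaryI)
    have "(conj_transpose U ** mat 1 ** U) $ q $ r = mat 1 $ q $ r" for q r
      unfolding conj_mult_nth by (simp add: col orth) (simp add: mat_def)
    then show "conj_transpose U ** U = mat 1"
      by (simp add: vec_eq_iff)
  qed
  have "conj_transpose U ** X p ** U = mat_scale (\<xi> p) (mat_unit p p)" for p
  proof -
    have "(conj_transpose U ** X p ** U) $ q $ r = mat_scale (\<xi> p) (mat_unit p p) $ q $ r" for q r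
      unfolding conj_mult_nth col
      by (cases "r = p"; cases "q = p")
        (simp_all add: \<xi>_def cdot_adjoint[of _ "X p"] ker(2),
          simp_all add: ker cdot_adjoint[symmetric])
    then show ?thesis by (simp add: vec_eq_iff)
  qed
  then have "X p = U ** mat_scale (\<xi> p) (mat_unit p p) ** conj_transpose U" for p
    by (metis \<open>unitary U\<close> unitary_conj_cancel(2))
  then show ?thesis
    using that[of U \<xi>] \<open>unitary U\<close> \<xi> by (simp add: X_def mat_scale_mult_left mat_scale_mult_right)
qed

section \<open>The unimodular factor is constant\<close>

text \<open>A form on \<open>\<complex>\<^sup>2\<close> of modulus \<open>1 + \<bar>c\<bar>\<^sup>2\<close> at \<open>(1, c)\<close> is a multiple of the squared norm:
  it takes the unit sphere to a subset of the unit circle, and the image is convex, hence a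
  point. The proof is by hand: the values at \<open>c\<close> equal to 0, \<open>\<plusminus>1\<close>, \<open>\<plusminus>2\<close>, \<open>\<plusminus>\<i>\<close>, \<open>\<plusminus>2\<i>\<close> and
  \<open>\<plusminus>(1 + \<i>)\<close> suffice.\<close>

lemma equal_ends_of_constant_modulus_form:
  fixes \<alpha> \<beta> q r :: complex
  assumes "cmod \<beta> = 1"
    and "\<And>c. cmod (\<alpha> + of_real ((cmod c)\<^sup>2) * \<beta> + c * q + cnj c * r) = 1 + (cmod c)\<^sup>2"
  shows "\<alpha> = \<beta>"
proof -
  define a where "a = \<alpha> / \<beta>"
  define v where "v = (q + r) / \<beta>"
  define w where "w = \<i> * (q - r) / \<beta>"
  have \<beta>: "\<beta> \<noteq> 0" using assms(1) by auto
  have scaled: "cmod (a + of_real ((cmod c)\<^sup>2) + c * (q / \<beta>) + cnj c * (r / \<beta>)) = 1 + (cmod c)\<^sup>2" for c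
  proof -
    have "a + of_real ((cmod c)\<^sup>2) + c * (q / \<beta>) + cnj c * (r / \<beta>)
        = (\<alpha> + of_real ((cmod c)\<^sup>2) * \<beta> + c * q + cnj c * r) / \<beta>"
      using \<beta> by (simp add: a_def field_simps)
    then show ?thesis using assms by (simp add: norm_divide)
  qed
  \<comment> \<open>In real coordinates \<open>c = x + \<i> y\<close> the form reads \<open>a + \<bar>c\<bar>\<^sup>2 + x v + y w\<close>.\<close>
  have key: "(cmod (a + of_real (x\<^sup>2 + y\<^sup>2) + of_real x * v + of_real y * w))\<^sup>2 = (1 + x\<^sup>2 + y\<^sup>2)\<^sup>2" for x y :: real
  proof -
    have "a + of_real (x\<^sup>2 + y\<^sup>2) + of_real x * v + of_real y * w
        = a + of_real ((cmod (Complex x y))\<^sup>2) + Complex x y * (q / \<beta>) + cnj (Complex x y) * (r / \<beta>)"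
      by (simp add: v_def w_def cmod_power2 Complex_eq add_divide_distrib diff_divide_distrib algebra_simps)
    then show ?thesis
      by (simp only: scaled) (simp add: cmod_power2 add.assoc)
  qed
  have key': "(Re a + (x\<^sup>2 + y\<^sup>2) + x * Re v + y * Re w)\<^sup>2 + (Im a + x * Im v + y * Im w)\<^sup>2
      = (1 + x\<^sup>2 + y\<^sup>2)\<^sup>2" for x y
    using key[of x y] by (simp add: cmod_power2)
  have a1: "(Re a)\<^sup>2 + (Im a)\<^sup>2 = 1"
    using key'[of 0 0] by simp
  note k = key'[of 1 0] key'[of "-1" 0] key'[of 2 0] key'[of "-2" 0]
  have v1: "Re v = 0"
    using k by (simp add: power2_eq_square algebra_simps)
  note l = key'[of 0 1] key'[of 0 "-1"] key'[of 0 2] key'[of 0 "-2"]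
  have w1: "Re w = 0"
    using l by (simp add: power2_eq_square algebra_simps)
  have "(Im v)\<^sup>2 = 2 - 2 * Re a"
    using k(1,2) a1 by (simp add: v1 power2_eq_square algebra_simps)
  moreover have "(Im w)\<^sup>2 = 2 - 2 * Re a"
    using l(1,2) a1 by (simp add: w1 power2_eq_square algebra_simps)
  moreover have "(Im v + Im w)\<^sup>2 = 4 - 4 * Re a"
    using key'[of 1 1] key'[of "-1" "-1"] a1 by (simp add: v1 w1 power2_eq_square algebra_simps)
  ultimately have "Im v * Im w = 0" "(Im v)\<^sup>2 = (Im w)\<^sup>2"
    by (simp_all add: power2_sum)
  then have "(Im v)\<^sup>2 = 0" by auto
  then have "Re a = 1"
    using \<open>(Im v)\<^sup>2 = 2 - 2 * Re a\<close> by simp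
  moreover from this have "Im a = 0" using a1 by simp
  ultimately have "a = 1" by (simp add: complex_eq_iff)
  then show ?thesis using \<beta> by (simp add: a_def)
qed

text \<open>Complex linearity for scalar-valued maps; \<open>complex_linear\<close> covers matrix-valued maps
  only.\<close>

definition matrix_functional :: "(complex ^ 'b ^ 'a \<Rightarrow> complex) \<Rightarrow> bool"
  where "matrix_functional f \<longleftrightarrow> (\<forall>X Y. f (X + Y) = f X + f Y) \<and> (\<forall>c X. f (mat_scale c X) = c * f X)"

lemma outer_axis_add:
  "outer (axis i 1 + c *s axis k 1) (axis i 1 + c *s axis k 1)
    = mat_unit i i + mat_scale (of_real ((cmod c)\<^sup>2)) (mat_unit k k)
      + mat_scale c (mat_unit k i) + mat_scale (cnj c) (mat_unit i k)"
  unfolding complex_norm_square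
  by (auto simp: vec_eq_iff axis_nth algebra_simps)

lemma diagonal_constant_if_modulus_norm:
  fixes f :: "'k::finite cmat \<Rightarrow> complex"
  assumes f: "matrix_functional f" and modulus: "\<And>x. cmod (f (outer x x)) = (norm x)\<^sup>2"
  shows "f (mat_unit i i) = f (mat_unit k k)"
proof (cases "i = k")
  case False
  show ?thesis
  proof (rule equal_ends_of_constant_modulus_form)
    show "cmod (f (mat_unit k k)) = 1"
      using modulus[of "axis k 1"] by (simp add: outer_axis)
    fix c
    let ?x = "axis i 1 + c *s axis k 1 :: complex ^ 'k"
    have "cdot ?x ?x = 1 + c * cnj c"
      using False by (simp add: cdot_add_left cdot_add_right cdot_scale_left cdot_scale_right cdot_axis
          axis_nth algebra_simps)
    also have "\<dots> = of_real (1 + (cmod c)\<^sup>2)"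
      unfolding of_real_add complex_norm_square by simp
    finally have "(norm ?x)\<^sup>2 = 1 + (cmod c)\<^sup>2"
      unfolding cdot_self by (simp only: of_real_eq_iff)
    moreover have "f (outer ?x ?x) = f (mat_unit i i) + of_real ((cmod c)\<^sup>2) * f (mat_unit k k)
        + c * f (mat_unit k i) + cnj c * f (mat_unit i k)"
      using f by (simp only: outer_axis_add matrix_functional_def)
    ultimately show "cmod (f (mat_unit i i) + of_real ((cmod c)\<^sup>2) * f (mat_unit k k)
        + c * f (mat_unit k i) + cnj c * f (mat_unit i k)) = 1 + (cmod c)\<^sup>2"
      using modulus[of ?x] by metis
  qed
qed simp

lemma trace_outer: "trace (outer u v) = cdot v u"
  by (simp add: trace_def cdot_def mult.commute)

lemma trace_scale: "trace (mat_scale c A) = c * trace A"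
  by (simp add: trace_def sum_distrib_left)

lemma radius_preserving_product_unit:
  fixes \<phi> :: "('m::finite \<times> 'n::finite) cmat \<Rightarrow> ('m \<times> 'n) cmat"
  assumes \<phi>: "radius_preserving \<phi>" and x: "norm x = 1" and y: "norm y = 1"
  obtains c u where "cmod c = 1" "norm u = 1" "\<phi> (outer x x \<otimes> outer y y) = mat_scale c (outer u u)"
proof -
  fix i :: 'm and j :: 'n
  obtain V where V: "unitary V" "V *v axis i 1 = x" using unitary_with_column[OF x] by blast
  obtain W where W: "unitary W" "W *v axis j 1 = y" using unitary_with_column[OF y] by blast
  obtain U \<xi> where U: "unitary U" "\<And>p. cmod (\<xi> p) = 1"
    "\<And>p. \<phi> ((V \<otimes> W) ** mat_unit p p ** conj_transpose (V \<otimes> W))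
      = mat_scale (\<xi> p) (U ** mat_unit p p ** conj_transpose U)"
    using radius_preserving_mat_unit[OF radius_preserving_conj[OF \<phi> V(1) W(1)]] by metis
  have "(V \<otimes> W) ** mat_unit (i, j) (i, j) ** conj_transpose (V \<otimes> W) = outer x x \<otimes> outer y y"
    unfolding mat_unit_kronecker[symmetric] unfolding outer_axis[symmetric]
    by (simp only: conj_transpose_kronecker kronecker_mult outer_conj V W)
  then have "\<phi> (outer x x \<otimes> outer y y)
      = mat_scale (\<xi> (i, j)) (outer (U *v axis (i, j) 1) (U *v axis (i, j) 1))"
    using U(3)[of "(i, j)"] by (simp add: outer_conj flip: outer_axis)
  moreover have "norm (U *v axis (i, j) 1) = 1"
    by (simp add: unitary_norm U)
  ultimately show ?thesis using that U(2) by blast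
qed

text \<open>A product vector of unit length extends to an orthonormal product basis, so its image
  is a phase times a rank-one projection. The trace turns this phase into a form in \<open>x\<close> and
  in \<open>y\<close>.\<close>

lemma radius_preserving_trace_modulus:
  fixes \<phi> :: "('m::finite \<times> 'n::finite) cmat \<Rightarrow> ('m \<times> 'n) cmat"
  assumes \<phi>: "radius_preserving \<phi>"
  shows "cmod (trace (\<phi> (outer x x \<otimes> outer y y))) = (norm x)\<^sup>2 * (norm y)\<^sup>2"
proof -
  have lin: "complex_linear \<phi>" using \<phi> by (simp add: radius_preserving_def)
  define x' where "x' = (if x = 0 then axis (SOME i. True) 1 else of_real (1 / norm x) *s x)"
  define y' where "y' = (if y = 0 then axis (SOME i. True) 1 else of_real (1 / norm y) *s y)"
  have "norm x' = 1" "norm y' = 1"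
    by (auto simp only: x'_def y'_def of_real_scale split: if_split) auto
  have x: "x = of_real (norm x) *s x'" and y: "y = of_real (norm y) *s y'"
    by (auto simp: x'_def y'_def vec_eq_iff)
  obtain c u where c: "cmod c = 1" "norm u = 1" "\<phi> (outer x' x' \<otimes> outer y' y') = mat_scale c (outer u u)"
    using radius_preserving_product_unit[OF \<phi> \<open>norm x' = 1\<close> \<open>norm y' = 1\<close>] by blast
  have "outer x x \<otimes> outer y y = mat_scale (of_real ((norm x)\<^sup>2 * (norm y)\<^sup>2)) (outer x' x' \<otimes> outer y' y')"
    by (subst (1 2) x, subst (1 2) y)
      (simp add: outer_scale kronecker_linear power2_eq_square mult_ac)
  then have "trace (\<phi> (outer x x \<otimes> outer y y)) = of_real ((norm x)\<^sup>2 * (norm y)\<^sup>2) * c"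
    using c by (simp add: complex_linear_scale lin trace_scale trace_outer cdot_self)
  then show ?thesis using c by (simp add: norm_mult norm_power)
qed

lemma sum_mat_unit: "(\<Sum>p\<in>UNIV. U ** mat_unit p p ** conj_transpose U) = U ** conj_transpose U"
proof -
  have "(\<Sum>p\<in>UNIV. U ** mat_unit p p ** conj_transpose U)
      = (\<Sum>p\<in>UNIV. outer (U *v axis p 1) (U *v axis p 1))"
    by (simp only: outer_conj outer_axis[symmetric])
  also have "\<dots> = U ** conj_transpose U"
    by (simp add: vec_eq_iff matrix_matrix_mult_def mult_axis_nth)
  finally show ?thesis .
qed

lemma mat_scale_sum: "mat_scale c (sum f S) = (\<Sum>a\<in>S. mat_scale c (f a))"
  by (simp add: vec_eq_iff sum_distrib_left)

text \<open>The phases of the diagonal units agree along rows and along columns of the index grid,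
  since the trace of the image has constant modulus on product vectors. Recording
  \<open>\<phi> (mat 1)\<close> makes the common phase independent of the product basis.\<close>

lemma radius_preserving_scalar_unit:
  fixes \<phi> :: "('m::finite \<times> 'n::finite) cmat \<Rightarrow> ('m \<times> 'n) cmat"
  assumes \<phi>: "radius_preserving \<phi>"
  obtains U \<xi> where "unitary U" "cmod \<xi> = 1" "\<phi> (mat 1) = mat_scale \<xi> (mat 1)"
    "\<And>p. \<phi> (mat_unit p p) = mat_scale \<xi> (U ** mat_unit p p ** conj_transpose U)"
proof -
  have lin: "complex_linear \<phi>" using \<phi> by (simp add: radius_preserving_def)
  obtain U \<xi> where U: "unitary U" and \<xi>: "\<And>p. cmod (\<xi> p) = 1"
    and eq: "\<And>p. \<phi> (mat_unit p p) = mat_scale (\<xi> p) (U ** mat_unit p p ** conj_transpose U)"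
    using radius_preserving_mat_unit[OF \<phi>] by blast
  have tr: "trace (\<phi> (mat_unit p p)) = \<xi> p" for p
    unfolding eq unfolding trace_scale outer_axis[symmetric] outer_conj trace_outer cdot_self
    by (simp add: unitary_norm U)
  have row: "\<xi> (i, j) = \<xi> (k, j)" for i k j
  proof -
    let ?f = "\<lambda>A. trace (\<phi> (A \<otimes> mat_unit j j))"
    have "?f (mat_unit i i) = ?f (mat_unit k k)"
    proof (rule diagonal_constant_if_modulus_norm)
      show "matrix_functional ?f"
        by (simp add: matrix_functional_def kronecker_linear complex_linear_add complex_linear_scale
            lin trace_add trace_scale)
      show "cmod (?f (outer x x)) = (norm x)\<^sup>2" for x
        using radius_preserving_trace_modulus[OF \<phi>, of x "axis j 1"] by (simp add: outer_axis)
    qed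
    then show ?thesis by (simp add: mat_unit_kronecker tr)
  qed
  have column: "\<xi> (i, j) = \<xi> (i, l)" for i j l
  proof -
    let ?f = "\<lambda>B. trace (\<phi> (mat_unit i i \<otimes> B))"
    have "?f (mat_unit j j) = ?f (mat_unit l l)"
    proof (rule diagonal_constant_if_modulus_norm)
      show "matrix_functional ?f"
        by (simp add: matrix_functional_def kronecker_linear complex_linear_add complex_linear_scale
            lin trace_add trace_scale)
      show "cmod (?f (outer x x)) = (norm x)\<^sup>2" for x
        using radius_preserving_trace_modulus[OF \<phi>, of "axis i 1" x] by (simp add: outer_axis)
    qed
    then show ?thesis by (simp add: mat_unit_kronecker tr)
  qed
  obtain q where "\<And>p. \<xi> p = \<xi> q"
    using row column by (metis surj_pair)
  then have eq': "\<phi> (mat_unit p p) = mat_scale (\<xi> q) (U ** mat_unit p p ** conj_transpose U)" for p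
    by (metis eq)
  have "\<phi> (mat 1) = \<phi> (\<Sum>p\<in>UNIV. mat_unit p p)"
    using sum_mat_unit[of "mat 1 :: ('m \<times> 'n) cmat"] by simp
  also have "\<dots> = mat_scale (\<xi> q) (\<Sum>p\<in>UNIV. U ** mat_unit p p ** conj_transpose U)"
    by (simp add: complex_linear_sum lin eq' mat_scale_sum)
  also have "\<dots> = mat_scale (\<xi> q) (mat 1)"
    by (simp add: sum_mat_unit unitaryD U)
  finally show ?thesis using that U \<xi> eq' by blast
qed

text \<open>Any product basis yields the same scalar matrix \<open>\<phi> (mat 1)\<close>, so the phase \<open>\<xi>\<close> does not
  depend on the product vector, and \<open>\<phi>\<close> divided by \<open>\<xi>\<close> sends product states to positive
  rank-one matrices.\<close>

lemma radius_preserving_normalize: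
  fixes \<phi> :: "('m::finite \<times> 'n::finite) cmat \<Rightarrow> ('m \<times> 'n) cmat"
  assumes \<phi>: "radius_preserving \<phi>"
  obtains U \<xi> where "unitary U" "cmod \<xi> = 1"
    "\<And>p. \<phi> (mat_unit p p) = mat_scale \<xi> (U ** mat_unit p p ** conj_transpose U)"
    "\<And>x y. \<exists>u. \<phi> (outer x x \<otimes> outer y y) = mat_scale \<xi> (outer u u)"
proof -
  have lin: "complex_linear \<phi>" using \<phi> by (simp add: radius_preserving_def)
  obtain U \<xi> where U: "unitary U" and \<xi>: "cmod \<xi> = 1" and one: "\<phi> (mat 1) = mat_scale \<xi> (mat 1)"
    and eq: "\<And>p. \<phi> (mat_unit p p) = mat_scale \<xi> (U ** mat_unit p p ** conj_transpose U)"
    using radius_preserving_scalar_unit[OF \<phi>] by blast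
  have unit: "\<exists>u. \<phi> (outer x x \<otimes> outer y y) = mat_scale \<xi> (outer u u)" if x: "norm x = 1" and y: "norm y = 1" for x y
  proof -
    fix i :: 'm and j :: 'n
    obtain V where V: "unitary V" "V *v axis i 1 = x" using unitary_with_column[OF x] by blast
    obtain W where W: "unitary W" "W *v axis j 1 = y" using unitary_with_column[OF y] by blast
    let ?\<phi> = "\<lambda>X. \<phi> ((V \<otimes> W) ** X ** conj_transpose (V \<otimes> W))"
    obtain U' \<xi>' where U': "unitary U'" "?\<phi> (mat 1) = mat_scale \<xi>' (mat 1)"
      "\<And>p. ?\<phi> (mat_unit p p) = mat_scale \<xi>' (U' ** mat_unit p p ** conj_transpose U')"
      using radius_preserving_scalar_unit[OF radius_preserving_conj[OF \<phi> V(1) W(1)]] by metis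
    have "mat_scale \<xi>' (mat 1) = mat_scale \<xi> (mat 1 :: ('m \<times> 'n) cmat)"
      using U'(2) by (simp add: unitaryD unitary_kronecker V W one)
    then have "mat_scale \<xi>' (mat 1) $ (i, j) $ (i, j) = mat_scale \<xi> (mat 1 :: ('m \<times> 'n) cmat) $ (i, j) $ (i, j)"
      by simp
    then have "\<xi>' = \<xi>" by (simp add: mat_def)
    have "(V \<otimes> W) ** mat_unit (i, j) (i, j) ** conj_transpose (V \<otimes> W) = outer x x \<otimes> outer y y"
      unfolding mat_unit_kronecker[symmetric] unfolding outer_axis[symmetric]
      by (simp only: conj_transpose_kronecker kronecker_mult outer_conj V W)
    then have "\<phi> (outer x x \<otimes> outer y y)
        = mat_scale \<xi> (outer (U' *v axis (i, j) 1) (U' *v axis (i, j) 1))"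
      using U'(3)[of "(i, j)"] \<open>\<xi>' = \<xi>\<close> by (simp add: outer_conj flip: outer_axis)
    then show ?thesis by blast
  qed
  have "\<exists>u. \<phi> (outer x x \<otimes> outer y y) = mat_scale \<xi> (outer u u)" for x y
  proof (cases "x = 0 \<or> y = 0")
    case True
    then have "outer x x \<otimes> outer y y = 0" by (auto simp: vec_eq_iff)
    moreover have "outer 0 0 = (0 :: ('m \<times> 'n) cmat)" by (simp add: vec_eq_iff)
    moreover have "mat_scale \<xi> (0 :: ('m \<times> 'n) cmat) = 0" by (simp add: vec_eq_iff)
    ultimately show ?thesis using complex_linear_zero[OF lin] by metis
  next
    case False
    define x' where "x' = of_real (1 / norm x) *s x"
    define y' where "y' = of_real (1 / norm y) *s y"
    have "norm x' = 1" "norm y' = 1"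
      unfolding x'_def y'_def of_real_scale using False by simp_all
    then obtain u where u: "\<phi> (outer x' x' \<otimes> outer y' y') = mat_scale \<xi> (outer u u)"
      using unit by blast
    have x: "x = of_real (norm x) *s x'" and y: "y = of_real (norm y) *s y'"
      using False by (auto simp: x'_def y'_def vec_eq_iff)
    let ?c = "complex_of_real (norm x * norm y)"
    have "outer x x \<otimes> outer y y = mat_scale (?c * cnj ?c) (outer x' x' \<otimes> outer y' y')"
      by (subst (1 2) x, subst (1 2) y) (simp add: outer_scale kronecker_linear mult_ac)
    then have "\<phi> (outer x x \<otimes> outer y y) = mat_scale \<xi> (outer (?c *s u) (?c *s u))"
      by (simp add: complex_linear_scale lin u outer_scale mult_ac)
    then show ?thesis by blast
  qed
  then show ?thesis using that U \<xi> eq by blast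
qed

section \<open>Functionals on rank-one matrices\<close>

lemma matrix_functional_add: "matrix_functional f \<Longrightarrow> f (X + Y) = f X + f Y"
  and matrix_functional_scale: "matrix_functional f \<Longrightarrow> f (mat_scale c X) = c * f X"
  by (simp_all add: matrix_functional_def)

lemma matrix_functional_sum: "matrix_functional f \<Longrightarrow> f (sum g S) = (\<Sum>a\<in>S. f (g a))"
proof (induction S rule: infinite_finite_induct)
  case (infinite S)
  then show ?case using matrix_functional_scale[of f 0 0] by simp
next
  case empty
  then show ?case using matrix_functional_scale[of f 0 0] by simp
qed (simp add: matrix_functional_add)

lemma double_sum_single:
  fixes g :: "'a::finite \<Rightarrow> 'b::finite \<Rightarrow> complex"
  assumes "\<And>a b. \<not> (a = i \<and> b = k) \<Longrightarrow> g a b = 0"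
  shows "(\<Sum>a\<in>UNIV. \<Sum>b\<in>UNIV. g a b) = g i k"
proof -
  have "(\<Sum>b\<in>UNIV. g a b) = (if a = i then g i k else 0)" for a
  proof (cases "a = i")
    case True
    have "(\<Sum>b\<in>UNIV. g i b) = (\<Sum>b\<in>{k}. g i b)"
      by (rule sum.mono_neutral_right) (auto simp: assms)
    then show ?thesis using True by simp
  next
    case False
    then show ?thesis by (simp add: assms)
  qed
  then show ?thesis by simp
qed

lemma matrix_functional_expand:
  fixes A :: "complex ^ 'b::finite ^ 'a::finite"
  assumes "matrix_functional f"
  shows "f A = (\<Sum>a\<in>UNIV. \<Sum>b\<in>UNIV. A $ a $ b * f (mat_unit a b))"
proof -
  have "A = (\<Sum>a\<in>UNIV. \<Sum>b\<in>UNIV. mat_scale (A $ a $ b) (mat_unit a b))"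
  proof -
    have "(\<Sum>a\<in>UNIV. \<Sum>b\<in>UNIV. A $ a $ b * (if i = a \<and> j = b then 1 else 0)) = A $ i $ j" for i j
      by (subst double_sum_single[of i j]) auto
    then show ?thesis by (simp add: vec_eq_iff)
  qed
  then have "f A = f (\<Sum>a\<in>UNIV. \<Sum>b\<in>UNIV. mat_scale (A $ a $ b) (mat_unit a b))"
    by simp
  then show ?thesis
    by (simp add: matrix_functional_sum matrix_functional_scale assms)
qed

lemma matrix_functional_outer_axis_add:
  assumes "matrix_functional f"
  shows "f (outer (axis a 1 + c *s axis b 1) (axis a 1 + c *s axis b 1))
    = f (mat_unit a a) + of_real ((cmod c)\<^sup>2) * f (mat_unit b b)
      + (c * f (mat_unit b a) + cnj c * f (mat_unit a b))"
  unfolding outer_axis_add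
  by (simp only: matrix_functional_add matrix_functional_scale assms add.assoc)

lemma matrix_functional_outer_single:
  fixes f :: "'k::finite cmat \<Rightarrow> complex"
  assumes f: "matrix_functional f"
    and zero: "\<And>a b. \<not> (a = i \<and> b = k) \<Longrightarrow> f (mat_unit a b) = 0"
  shows "f (outer x x) = f (mat_unit i k) * x $ i * cnj (x $ k)"
proof -
  have "f (outer x x) = (\<Sum>a\<in>UNIV. \<Sum>b\<in>UNIV. x $ a * cnj (x $ b) * f (mat_unit a b))"
    by (simp add: matrix_functional_expand[OF f, of "outer x x"])
  also have "\<dots> = x $ i * cnj (x $ k) * f (mat_unit i k)"
    by (rule double_sum_single) (simp add: zero)
  finally show ?thesis by simp
qed

text \<open>The parallelogram identity for \<open>x \<plusminus> axis i 1\<close> recovers the vectors with \<open>x $ i = 0\<close>,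
  and polarization then recovers the matrix units. Allowing the exceptional vectors makes it
  possible to divide by \<open>x $ i\<close> when checking the hypothesis.\<close>

lemma matrix_functional_eqI:
  fixes f g :: "'k::finite cmat \<Rightarrow> complex"
  assumes f: "matrix_functional f" and g: "matrix_functional g"
    and eq: "\<And>x. x $ i \<noteq> 0 \<Longrightarrow> f (outer x x) = g (outer x x)"
  shows "f A = g A"
proof -
  have outer: "f (outer x x) = g (outer x x)" for x
  proof (cases "x $ i = 0")
    case True
    let ?e = "axis i 1 :: complex ^ 'k"
    have par: "outer (x + ?e) (x + ?e) + outer (x + (-1) *s ?e) (x + (-1) *s ?e)
        = mat_scale 2 (outer x x) + mat_scale 2 (outer ?e ?e)"
      by (simp add: vec_eq_iff algebra_simps)
    have "f (outer (x + ?e) (x + ?e)) + f (outer (x + (-1) *s ?e) (x + (-1) *s ?e))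
        = 2 * f (outer x x) + 2 * f (outer ?e ?e)"
      using arg_cong[OF par, of f] by (simp only: matrix_functional_add matrix_functional_scale f)
    moreover have "g (outer (x + ?e) (x + ?e)) + g (outer (x + (-1) *s ?e) (x + (-1) *s ?e))
        = 2 * g (outer x x) + 2 * g (outer ?e ?e)"
      using arg_cong[OF par, of g] by (simp only: matrix_functional_add matrix_functional_scale g)
    moreover have "(x + ?e) $ i \<noteq> 0" "(x + (-1) *s ?e) $ i \<noteq> 0" "?e $ i \<noteq> 0"
      using True by (simp_all add: axis_nth)
    ultimately show ?thesis by (simp add: eq)
  qed (rule eq)
  have unit: "f (mat_unit a b) = g (mat_unit a b)" for a b
  proof -
    have diag: "f (mat_unit c c) = g (mat_unit c c)" for c
      using outer[of "axis c 1"] by (simp add: outer_axis)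
    have "c * f (mat_unit b a) + cnj c * f (mat_unit a b)
        = c * g (mat_unit b a) + cnj c * g (mat_unit a b)" for c
      using outer[of "axis a 1 + c *s axis b 1"]
      unfolding matrix_functional_outer_axis_add[OF f] matrix_functional_outer_axis_add[OF g] diag
      by simp
    from this[of 1] this[of \<i>]
    have "f (mat_unit b a) + f (mat_unit a b) = g (mat_unit b a) + g (mat_unit a b)"
      "\<i> * (f (mat_unit b a) - f (mat_unit a b)) = \<i> * (g (mat_unit b a) - g (mat_unit a b))"
      by (simp_all add: algebra_simps)
    then show ?thesis by simp algebra
  qed
  show ?thesis
    unfolding matrix_functional_expand[OF f, of A] matrix_functional_expand[OF g, of A] unit ..
qed

lemma nonneg_affine_zero:
  assumes "\<And>c. K + (c * \<alpha> + cnj c * \<beta>) \<in> \<real>\<^sub>\<ge>\<^sub>0"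
  shows "\<alpha> = 0 \<and> \<beta> = 0"
proof -
  have "0 \<le> Re K + s * Re (\<alpha> + \<beta>)" "Im K + s * Im (\<alpha> + \<beta>) = 0"
    "0 \<le> Re K + s * Im (\<beta> - \<alpha>)" "Im K + s * Re (\<alpha> - \<beta>) = 0" for s
    using assms[of "of_real s"] assms[of "of_real s * \<i>"]
    by (simp_all add: complex_nonneg_Reals_iff algebra_simps)
  note * = this
  have zero: "t = 0" if "\<And>s. 0 \<le> k + s * t" for k t :: real
    using that[of "- (k + 1) / t"] by (cases "t = 0") auto
  have "Re (\<alpha> + \<beta>) = 0" by (rule zero) (rule *(1))
  moreover have "Im (\<beta> - \<alpha>) = 0" by (rule zero) (rule *(3))
  moreover have "Im (\<alpha> + \<beta>) = 0" using *(2)[of 0] *(2)[of 1] by simp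
  moreover have "Re (\<alpha> - \<beta>) = 0" using *(4)[of 0] *(4)[of 1] by simp
  ultimately show ?thesis by (simp add: complex_eq_iff)
qed

text \<open>A positive semidefinite matrix has zero row and column wherever its diagonal entry is
  zero.\<close>

lemma nonneg_functional_outer:
  fixes f :: "'k::finite cmat \<Rightarrow> complex"
  assumes f: "matrix_functional f" and nonneg: "\<And>x. f (outer x x) \<in> \<real>\<^sub>\<ge>\<^sub>0"
    and diag: "\<And>a. a \<noteq> i \<Longrightarrow> f (mat_unit a a) = 0"
  shows "f (outer x x) = f (mat_unit i i) * of_real ((cmod (x $ i))\<^sup>2)"
proof -
  have off: "f (mat_unit a b) = 0 \<and> f (mat_unit b a) = 0" if "b \<noteq> i" for a b
  proof -
    have "f (mat_unit a a) + (c * f (mat_unit b a) + cnj c * f (mat_unit a b)) \<in> \<real>\<^sub>\<ge>\<^sub>0" for c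
      using nonneg[of "axis a 1 + c *s axis b 1"]
      unfolding matrix_functional_outer_axis_add[OF f] diag[OF that] by simp
    then show ?thesis using nonneg_affine_zero by blast
  qed
  have "f (outer x x) = f (mat_unit i i) * x $ i * cnj (x $ i)"
    by (rule matrix_functional_outer_single[OF f]) (use off in metis)
  then show ?thesis unfolding complex_norm_square by (simp add: mult.assoc)
qed

lemma conj_linear_zero:
  fixes \<alpha> \<beta> :: complex
  assumes "\<And>c. c * \<alpha> + cnj c * \<beta> = 0"
  shows "\<alpha> = 0 \<and> \<beta> = 0"
  using nonneg_affine_zero[of 0 \<alpha> \<beta>] assms by simp

lemma parallelogram_complex:
  "(cmod (a + b))\<^sup>2 + (cmod (a - b))\<^sup>2 = 2 * (cmod a)\<^sup>2 + 2 * (cmod b)\<^sup>2"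
  unfolding cmod_power2 by (simp add: power2_eq_square algebra_simps)

text \<open>Along a line \<open>axis a 1 + c *s axis b 1\<close> with \<open>b \<noteq> i\<close> the form is affine in \<open>c\<close> and
  \<open>cnj c\<close>, with constant modulus, so its linear part vanishes by the parallelogram identity.
  The coefficient is written as the value at the all-one vector, which is the form in which
  it can be compared between different functionals.\<close>

lemma modulus_square_functional_outer:
  fixes f :: "'k::finite cmat \<Rightarrow> complex"
  assumes f: "matrix_functional f" and modulus: "\<And>x. cmod (f (outer x x)) = C * (cmod (x $ i))\<^sup>2"
  shows "f (outer x x) = f (outer 1 1) * of_real ((cmod (x $ i))\<^sup>2)"
proof -
  have diag: "f (mat_unit a a) = 0" if "a \<noteq> i" for a
    using modulus[of "axis a 1"] that by (simp add: outer_axis axis_nth)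
  have off: "f (mat_unit a b) = 0 \<and> f (mat_unit b a) = 0" if "b \<noteq> i" "a \<noteq> b" for a b
  proof -
    have "c * f (mat_unit b a) + cnj c * f (mat_unit a b) = 0" for c
    proof -
      let ?z = "c * f (mat_unit b a) + cnj c * f (mat_unit a b)"
      have "cmod (f (mat_unit a a) + (d * f (mat_unit b a) + cnj d * f (mat_unit a b)))
          = cmod (f (mat_unit a a))" for d
        using modulus[of "axis a 1 + d *s axis b 1"] modulus[of "axis a 1"] that
        unfolding matrix_functional_outer_axis_add[OF f] diag[OF that(1)] outer_axis
        by (simp add: axis_nth)
      from this[of c] this[of "- c"]
      have "cmod (f (mat_unit a a) + ?z) = cmod (f (mat_unit a a))"
        "cmod (f (mat_unit a a) - ?z) = cmod (f (mat_unit a a))"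
        by (simp_all add: algebra_simps)
      then have "(cmod ?z)\<^sup>2 = 0"
        using parallelogram_complex[of "f (mat_unit a a)" ?z] by simp
      then show ?thesis by simp
    qed
    then show ?thesis using conj_linear_zero by blast
  qed
  have "f (outer x x) = f (mat_unit i i) * x $ i * cnj (x $ i)" for x
    by (rule matrix_functional_outer_single[OF f]) (use off diag in metis)
  from this[of x] this[of 1] show ?thesis
    unfolding complex_norm_square by (simp add: mult.assoc)
qed

text \<open>The hypothesis kills every coefficient except those of \<open>x $ i * cnj (x $ k)\<close> and of
  its conjugate, and a combination \<open>c \<alpha> + cnj c \<beta>\<close> whose modulus depends only on \<open>\<bar>c\<bar>\<close> has
  \<open>\<alpha> = 0\<close> or \<open>\<beta> = 0\<close>. The alternative between the identity and the transposition originates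
  here.\<close>

lemma modulus_product_functional_outer:
  fixes f :: "'k::finite cmat \<Rightarrow> complex"
  assumes f: "matrix_functional f" and ik: "i \<noteq> k"
    and modulus: "\<And>x. cmod (f (outer x x)) = C * cmod (x $ i) * cmod (x $ k)"
  shows "(\<forall>x. f (outer x x) = f (outer 1 1) * (x $ i * cnj (x $ k)))
    \<or> (\<forall>x. f (outer x x) = f (outer 1 1) * (x $ k * cnj (x $ i)))"
proof -
  have diag: "f (mat_unit a a) = 0" for a
    using modulus[of "axis a 1"] ik by (cases "i = a") (auto simp: outer_axis axis_nth)
  have cmod_eq: "cmod (c * f (mat_unit b a) + cnj c * f (mat_unit a b))
      = C * cmod ((axis a 1 + c *s axis b 1) $ i) * cmod ((axis a 1 + c *s axis b 1) $ k)" for a b c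
    using modulus[of "axis a 1 + c *s axis b 1"]
    unfolding matrix_functional_outer_axis_add[OF f] diag by simp
  have off: "f (mat_unit a b) = 0" if "\<not> (a = i \<and> b = k)" "\<not> (a = k \<and> b = i)" for a b
  proof (cases "a = b")
    case False
    then have "c * f (mat_unit b a) + cnj c * f (mat_unit a b) = 0" for c
      using cmod_eq[of c b a] that ik by (auto simp: axis_nth split: if_splits)
    then show ?thesis using conj_linear_zero by blast
  qed (simp add: diag)
  let ?\<alpha> = "f (mat_unit k i)" and ?\<beta> = "f (mat_unit i k)"
  have "?\<alpha> = 0 \<or> ?\<beta> = 0"
  proof -
    have "cmod (c * ?\<alpha> + cnj c * ?\<beta>) = C * cmod c" for c
      using cmod_eq[of c k i] ik by (simp add: axis_nth)
    then have sq: "(cmod (c * ?\<alpha> + cnj c * ?\<beta>))\<^sup>2 = C\<^sup>2 * (cmod c)\<^sup>2" for c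
      by (simp add: power_mult_distrib)
    have "Re (?\<alpha> * cnj ?\<beta>) = 0"
      using sq[of 1] sq[of \<i>] unfolding cmod_power2 by (simp add: power2_eq_square algebra_simps)
    moreover have "Im (?\<alpha> * cnj ?\<beta>) = 0"
      using sq[of "1 + \<i>"] sq[of "1 - \<i>"] unfolding cmod_power2
      by (simp add: power2_eq_square algebra_simps)
    ultimately have "?\<alpha> * cnj ?\<beta> = 0" by (simp add: complex_eq_iff)
    then show ?thesis by simp
  qed
  then show ?thesis
  proof
    assume "?\<alpha> = 0"
    then have "f (outer x x) = f (mat_unit i k) * x $ i * cnj (x $ k)" for x
      by (intro matrix_functional_outer_single[OF f]) (use off in metis)
    from this this[of 1] show ?thesis by (simp add: mult.assoc)
  next
    assume "?\<beta> = 0"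
    then have "f (outer x x) = f (mat_unit k i) * x $ k * cnj (x $ i)" for x
      by (intro matrix_functional_outer_single[OF f]) (use off in metis)
    from this this[of 1] show ?thesis by (simp add: mult.assoc)
  qed
qed

section \<open>Maps that preserve the moduli of rank-one matrices\<close>

lemma matrix_functional_nth: "complex_linear L \<Longrightarrow> matrix_functional (\<lambda>A. L A $ p $ q)"
  by (simp add: matrix_functional_def complex_linear_iff)

text \<open>Each entry of \<open>L (outer x x)\<close> is a multiple of the corresponding entry of \<open>outer x x\<close>
  or of its conjugate. All entries in the column of a base index \<open>e\<close> must be of the same
  kind: the 2-by-2 minors of a rank-one matrix express the entry \<open>(a, b)\<close> through that
  column, and entries of different kinds would make it depend on the phase of \<open>x $ e\<close>. The
  phases of the multiples are then those of the base column.\<close>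

lemma modulus_preserving_classification:
  fixes L :: "'k::finite cmat \<Rightarrow> 'k cmat"
  assumes L: "complex_linear L"
    and rank1: "\<And>x. \<exists>v. L (outer x x) = outer v v \<and> (\<forall>a. cmod (v $ a) = cmod (x $ a))"
  obtains d \<tau> where "\<And>a. cmod (d a) = 1" "\<tau> = id \<or> \<tau> = transpose"
    "\<And>A a b. L A $ a $ b = d a * cnj (d b) * \<tau> A $ a $ b"
proof -
  \<comment> \<open>an arbitrary base index\<close>
  fix e :: 'k
  define d where "d a = L (outer 1 1) $ a $ e" for a
  have cmod_L: "cmod (L (outer x x) $ a $ b) = cmod (x $ a) * cmod (x $ b)" for x a b
    using rank1[of x] by (auto simp: norm_mult)
  have herm: "L (outer x x) $ a $ b = cnj (L (outer x x) $ b $ a)" for x a b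
    using rank1[of x] by auto
  have minor: "L (outer x x) $ a $ b * of_real ((cmod (x $ e))\<^sup>2)
      = L (outer x x) $ a $ e * cnj (L (outer x x) $ b $ e)" for x a b
  proof -
    obtain v where v: "L (outer x x) = outer v v" "\<And>a. cmod (v $ a) = cmod (x $ a)"
      using rank1[of x] by blast
    show ?thesis unfolding v(2)[symmetric] complex_norm_square by (simp add: v(1) mult_ac)
  qed
  have d: "cmod (d a) = 1" for a by (simp add: d_def cmod_L)
  have fn: "matrix_functional (\<lambda>A. L A $ a $ b)" for a b
    by (rule matrix_functional_nth[OF L])
  have ee: "L (outer x x) $ e $ e = of_real ((cmod (x $ e))\<^sup>2)" for x
  proof -
    obtain v where v: "L (outer x x) = outer v v" "\<And>a. cmod (v $ a) = cmod (x $ a)"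
      using rank1[of x] by blast
    show ?thesis unfolding v(2)[symmetric] complex_norm_square by (simp add: v(1))
  qed
  define straight where "straight a \<longleftrightarrow> (\<forall>x. L (outer x x) $ a $ e = d a * (x $ a * cnj (x $ e)))" for a
  define swapped where "swapped a \<longleftrightarrow> (\<forall>x. L (outer x x) $ a $ e = d a * (x $ e * cnj (x $ a)))" for a
  have "d e = 1" by (simp add: d_def ee)
  then have "straight e" "swapped e"
    unfolding straight_def swapped_def ee complex_norm_square by simp_all
  have dichotomy: "straight a \<or> swapped a" for a
  proof (cases "a = e")
    case False
    show ?thesis unfolding straight_def swapped_def d_def
      by (rule modulus_product_functional_outer[OF fn[of a e] False, of 1]) (simp add: cmod_L)
  qed (simp add: \<open>straight e\<close>)
  have "(\<forall>a. straight a) \<or> (\<forall>a. swapped a)"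
  proof (rule ccontr)
    assume "\<not> ?thesis"
    then obtain a b where ab: "\<not> straight a" "\<not> swapped b" by blast
    then have "swapped a" "straight b" using dichotomy by blast+
    then have "a \<noteq> e" "b \<noteq> e" "a \<noteq> b" using ab \<open>straight e\<close> \<open>swapped e\<close> by blast+
    \<comment> \<open>Turning the phase at \<open>e\<close> by \<open>\<i>\<close> leaves the entry \<open>(a, b)\<close> unchanged, but the base column says that it
      changes sign.\<close>
    define z :: "complex ^ 'k" where "z = (\<chi> c. if c = e then \<i> else 1)"
    have z: "z $ e = \<i>" "z $ a = 1" "z $ b = 1"
      using \<open>a \<noteq> e\<close> \<open>b \<noteq> e\<close> by (simp_all add: z_def)
    have "(\<forall>x. L (outer x x) $ a $ b = L (outer 1 1) $ a $ b * (x $ a * cnj (x $ b)))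
        \<or> (\<forall>x. L (outer x x) $ a $ b = L (outer 1 1) $ a $ b * (x $ b * cnj (x $ a)))"
      by (rule modulus_product_functional_outer[OF fn[of a b] \<open>a \<noteq> b\<close>, of 1]) (simp add: cmod_L)
    then have "L (outer z z) $ a $ b = L (outer 1 1) $ a $ b * (z $ a * cnj (z $ b))
        \<or> L (outer z z) $ a $ b = L (outer 1 1) $ a $ b * (z $ b * cnj (z $ a))"
      by blast
    then have "L (outer z z) $ a $ b = L (outer 1 1) $ a $ b"
      by (simp add: z)
    moreover have "L (outer z z) $ a $ b = - (d a * cnj (d b))"
      using minor[of z a b] \<open>swapped a\<close> \<open>straight b\<close>
      by (simp add: swapped_def straight_def z mult_ac)
    moreover have "L (outer 1 1) $ a $ b = d a * cnj (d b)"
      using minor[of 1 a b] by (simp add: d_def)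
    ultimately have "d a * cnj (d b) = 0" by simp
    then show False using d[of a] d[of b] by auto
  qed
  then show ?thesis
  proof
    assume *: "\<forall>a. straight a"
    have "L A $ a $ b = d a * cnj (d b) * id A $ a $ b" for A a b
    proof (rule matrix_functional_eqI[OF fn])
      show "matrix_functional (\<lambda>A. d a * cnj (d b) * id A $ a $ b)"
        by (simp add: matrix_functional_def algebra_simps)
      fix x :: "complex ^ 'k" assume "x $ e \<noteq> 0"
      then show "L (outer x x) $ a $ b = d a * cnj (d b) * id (outer x x) $ a $ b"
        using minor[of x a b] * unfolding complex_norm_square straight_def by simp
    qed
    then show ?thesis using that[of d id] d by blast
  next
    assume *: "\<forall>a. swapped a"
    have "L A $ a $ b = d a * cnj (d b) * transpose A $ a $ b" for A a b
    proof (rule matrix_functional_eqI[OF fn])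
      show "matrix_functional (\<lambda>A. d a * cnj (d b) * transpose A $ a $ b)"
        by (simp add: matrix_functional_def algebra_simps)
      fix x :: "complex ^ 'k" assume "x $ e \<noteq> 0"
      then show "L (outer x x) $ a $ b = d a * cnj (d b) * transpose (outer x x) $ a $ b"
        using minor[of x a b] * unfolding complex_norm_square swapped_def by simp
    qed
    then show ?thesis using that[of d transpose] d by blast
  qed
qed

section \<open>Maps sending product states to pure states\<close>

text \<open>The diagonal entry is a positive semidefinite form in \<open>y\<close> for each basis vector in
  place of \<open>x\<close>, and in \<open>x\<close> for each \<open>y\<close>; since \<open>\<psi>\<close> fixes the diagonal units, all but one of
  its diagonal coefficients vanish.\<close>

lemma product_rank_one_diagonal:
  fixes \<psi> :: "('m::finite \<times> 'n::finite) cmat \<Rightarrow> ('m \<times> 'n) cmat"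
  assumes \<psi>: "complex_linear \<psi>" and units: "\<And>p. \<psi> (mat_unit p p) = mat_unit p p"
    and rank1: "\<And>x y. \<exists>u. \<psi> (outer x x \<otimes> outer y y) = outer u u"
  shows "\<psi> (outer x x \<otimes> outer y y) $ (i, j) $ (i, j) = of_real ((cmod (x $ i))\<^sup>2 * (cmod (y $ j))\<^sup>2)"
proof -
  let ?p = "(i, j)"
  have nonneg: "\<psi> (outer x x \<otimes> outer y y) $ ?p $ ?p \<in> \<real>\<^sub>\<ge>\<^sub>0" for x y
  proof -
    obtain u where "\<psi> (outer x x \<otimes> outer y y) = outer u u" using rank1 by blast
    then have "\<psi> (outer x x \<otimes> outer y y) $ ?p $ ?p = of_real ((cmod (u $ ?p))\<^sup>2)"
      unfolding complex_norm_square by simp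
    then show ?thesis by (simp only: nonneg_Reals_of_real_iff zero_le_power2)
  qed
  have fn1: "matrix_functional (\<lambda>A. \<psi> (A \<otimes> B) $ ?p $ ?p)" for B
    using \<psi> by (simp add: matrix_functional_def kronecker_linear complex_linear_iff)
  have fn2: "matrix_functional (\<lambda>B. \<psi> (A \<otimes> B) $ ?p $ ?p)" for A
    using \<psi> by (simp add: matrix_functional_def kronecker_linear complex_linear_iff)
  have unit: "\<psi> (mat_unit a a \<otimes> mat_unit b b) $ ?p $ ?p = (if a = i \<and> b = j then 1 else 0)" for a b
    by (auto simp: mat_unit_kronecker units)
  have "\<psi> (mat_unit a a \<otimes> outer y y) $ ?p $ ?p
      = \<psi> (mat_unit a a \<otimes> mat_unit j j) $ ?p $ ?p * of_real ((cmod (y $ j))\<^sup>2)" for a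
    by (rule nonneg_functional_outer[OF fn2])
      (use nonneg[of "axis a 1"] in \<open>simp_all add: unit outer_axis\<close>)
  then have row: "\<psi> (mat_unit a a \<otimes> outer y y) $ ?p $ ?p = (if a = i then of_real ((cmod (y $ j))\<^sup>2) else 0)" for a
    by (simp add: unit)
  have "\<psi> (outer x x \<otimes> outer y y) $ ?p $ ?p
      = \<psi> (mat_unit i i \<otimes> outer y y) $ ?p $ ?p * of_real ((cmod (x $ i))\<^sup>2)"
    by (rule nonneg_functional_outer[OF fn1]) (simp_all add: row nonneg)
  then show ?thesis by (simp add: row)
qed

text \<open>The diagonal entries fix the moduli of all entries of the image of a product state.
  Setting one vector to the all-one vector leaves the one-factor maps \<open>L1\<close> and \<open>L2\<close>, to
  which the preceding classification applies. The minors through \<open>((i, j), (i, f))\<close> and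
  through \<open>((i, j), (e, j))\<close> both compute the entry in the column of the base pair \<open>(e, f)\<close>,
  and their comparison shows that this entry is a phase \<open>\<kappa>\<close> times the product of the
  one-factor entries. One more minor passes from the base column to all entries.\<close>

lemma product_rank_one_classification:
  fixes \<psi> :: "('m::finite \<times> 'n::finite) cmat \<Rightarrow> ('m \<times> 'n) cmat"
  assumes \<psi>: "complex_linear \<psi>" and units: "\<And>p. \<psi> (mat_unit p p) = mat_unit p p"
    and rank1: "\<And>x y. \<exists>u. \<psi> (outer x x \<otimes> outer y y) = outer u u"
  obtains d \<tau>1 \<tau>2 where "\<And>p. cmod (d p) = 1"
    "\<tau>1 = id \<or> \<tau>1 = transpose" "\<tau>2 = id \<or> \<tau>2 = transpose"
    "\<And>A B p q. \<psi> (A \<otimes> B) $ p $ q = d p * cnj (d q) * (\<tau>1 A \<otimes> \<tau>2 B) $ p $ q"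
proof -
  \<comment> \<open>an arbitrary base pair\<close>
  fix e :: 'm and f :: 'n
  define h where "h x y p q = \<psi> (outer x x \<otimes> outer y y) $ p $ q" for x y p q
  have fn1: "matrix_functional (\<lambda>A. \<psi> (A \<otimes> B) $ p $ q)" for B p q
    using \<psi> by (simp add: matrix_functional_def kronecker_linear complex_linear_iff)
  have fn2: "matrix_functional (\<lambda>B. \<psi> (A \<otimes> B) $ p $ q)" for A p q
    using \<psi> by (simp add: matrix_functional_def kronecker_linear complex_linear_iff)
  have "\<exists>u. \<psi> (outer x x \<otimes> outer y y) = outer u u \<and>
      (\<forall>i j. cmod (u $ (i, j)) = cmod (x $ i) * cmod (y $ j))" for x y
  proof -
    obtain u where u: "\<psi> (outer x x \<otimes> outer y y) = outer u u" using rank1 by blast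
    have "cmod (u $ (i, j)) = cmod (x $ i) * cmod (y $ j)" for i j
    proof -
      have "complex_of_real ((cmod (u $ (i, j)))\<^sup>2) = of_real ((cmod (x $ i))\<^sup>2 * (cmod (y $ j))\<^sup>2)"
        using product_rank_one_diagonal[OF assms, of x y i j]
        unfolding complex_norm_square u by simp
      then have "(cmod (u $ (i, j)))\<^sup>2 = (cmod (x $ i) * cmod (y $ j))\<^sup>2"
        unfolding of_real_eq_iff by (simp add: power_mult_distrib)
      then show ?thesis by (simp add: power2_eq_iff_nonneg)
    qed
    with u show ?thesis by blast
  qed
  then obtain u where u: "\<And>x y. \<psi> (outer x x \<otimes> outer y y) = outer (u x y) (u x y)"
    and cmod_u: "\<And>x y i j. cmod (u x y $ (i, j)) = cmod (x $ i) * cmod (y $ j)"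
    by metis
  have h_u: "h x y p q = u x y $ p * cnj (u x y $ q)" for x y p q
    by (simp add: h_def u)
  have h_diag: "h x y (i, j) (i, j) = of_real ((cmod (x $ i))\<^sup>2 * (cmod (y $ j))\<^sup>2)" for x y i j
    unfolding h_def by (rule product_rank_one_diagonal[OF assms])
  have cmod_h: "cmod (h x y (i, j) (k, l)) = cmod (x $ i) * cmod (y $ j) * (cmod (x $ k) * cmod (y $ l))"
    for x y i j k l
    by (simp add: h_u norm_mult cmod_u)
  have minor: "h x y p q * h x y r r = h x y p r * h x y r q" for x y p q r
    by (simp add: h_u)
  have herm: "h x y p q = cnj (h x y q p)" for x y p q
    by (simp add: h_u)

  define L1 :: "'m cmat \<Rightarrow> 'm cmat" where "L1 A = (\<chi> i k. \<psi> (A \<otimes> outer 1 1) $ (i, f) $ (k, f))" for A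
  define L2 :: "'n cmat \<Rightarrow> 'n cmat" where "L2 B = (\<chi> j l. \<psi> (outer 1 1 \<otimes> B) $ (e, j) $ (e, l))" for B
  have L1_nth: "L1 A $ i $ k = \<psi> (A \<otimes> outer 1 1) $ (i, f) $ (k, f)" for A i k by (simp add: L1_def)
  have L2_nth: "L2 B $ j $ l = \<psi> (outer 1 1 \<otimes> B) $ (e, j) $ (e, l)" for B j l by (simp add: L2_def)
  obtain d1 \<tau>1 where d1: "\<And>a. cmod (d1 a) = 1" "\<tau>1 = id \<or> \<tau>1 = transpose"
    "\<And>A a b. L1 A $ a $ b = d1 a * cnj (d1 b) * \<tau>1 A $ a $ b"
  proof (rule modulus_preserving_classification)
    show "complex_linear L1"
      using \<psi> by (simp add: complex_linear_iff vec_eq_iff L1_nth kronecker_linear)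
    fix x :: "complex ^ 'm"
    have "L1 (outer x x) = outer (\<chi> i. u x 1 $ (i, f)) (\<chi> i. u x 1 $ (i, f))"
      by (simp add: vec_eq_iff L1_nth u)
    then show "\<exists>v. L1 (outer x x) = outer v v \<and> (\<forall>a. cmod (v $ a) = cmod (x $ a))"
      by (intro exI[of _ "\<chi> i. u x 1 $ (i, f)"]) (simp add: cmod_u)
  qed blast
  obtain d2 \<tau>2 where d2: "\<And>a. cmod (d2 a) = 1" "\<tau>2 = id \<or> \<tau>2 = transpose"
    "\<And>B a b. L2 B $ a $ b = d2 a * cnj (d2 b) * \<tau>2 B $ a $ b"
  proof (rule modulus_preserving_classification)
    show "complex_linear L2"
      using \<psi> by (simp add: complex_linear_iff vec_eq_iff L2_nth kronecker_linear)
    fix y :: "complex ^ 'n"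
    have "L2 (outer y y) = outer (\<chi> j. u 1 y $ (e, j)) (\<chi> j. u 1 y $ (e, j))"
      by (simp add: vec_eq_iff L2_nth u)
    then show "\<exists>v. L2 (outer y y) = outer v v \<and> (\<forall>a. cmod (v $ a) = cmod (y $ a))"
      by (intro exI[of _ "\<chi> j. u 1 y $ (e, j)"]) (simp add: cmod_u)
  qed blast

  have first: "h x y (i, j) (i, l) = h 1 y (i, j) (i, l) * of_real ((cmod (x $ i))\<^sup>2)" for x y i j l
    unfolding h_def
  proof (rule modulus_square_functional_outer[OF fn1])
    show "cmod (\<psi> (outer x x \<otimes> outer y y) $ (i, j) $ (i, l))
        = (cmod (y $ j) * cmod (y $ l)) * (cmod (x $ i))\<^sup>2" for x
      using cmod_h[of x y i j i l] by (simp add: h_def power2_eq_square mult_ac)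
  qed
  have second: "h x y (i, j) (k, j) = h x 1 (i, j) (k, j) * of_real ((cmod (y $ j))\<^sup>2)" for x y i j k
    unfolding h_def
  proof (rule modulus_square_functional_outer[OF fn2])
    show "cmod (\<psi> (outer x x \<otimes> outer y y) $ (i, j) $ (k, j))
        = (cmod (x $ i) * cmod (x $ k)) * (cmod (y $ j))\<^sup>2" for y
      using cmod_h[of x y i j k j] by (simp add: h_def power2_eq_square mult_ac)
  qed

  define a where "a i x = h x 1 (i, f) (e, f)" for i x
  define b where "b j y = h 1 y (e, j) (e, f)" for j y
  have cmod_a: "cmod (a i x) = cmod (x $ i) * cmod (x $ e)" for i x by (simp add: a_def cmod_h)
  have cmod_b: "cmod (b j y) = cmod (y $ j) * cmod (y $ f)" for j y by (simp add: b_def cmod_h)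
  have via_first: "h x y (i, j) (e, f) = h 1 y (i, j) (i, f) * a i x" if "y $ f \<noteq> 0" for x y i j
  proof (cases "x $ i = 0")
    case True
    then have "cmod (h x y (i, j) (e, f)) = 0" "cmod (a i x) = 0" by (simp_all add: cmod_h cmod_a)
    then show ?thesis by simp
  next
    case False
    have "h x y (i, j) (e, f) * h x y (i, f) (i, f) = h x y (i, j) (i, f) * h x y (i, f) (e, f)"
      by (rule minor)
    then have "h x y (i, j) (e, f) * of_real ((cmod (x $ i))\<^sup>2 * (cmod (y $ f))\<^sup>2)
        = (h 1 y (i, j) (i, f) * a i x) * of_real ((cmod (x $ i))\<^sup>2 * (cmod (y $ f))\<^sup>2)"
      unfolding h_diag first[of x y i j f] second[of x y i f e] a_def by (simp add: mult_ac)
    moreover have "complex_of_real ((cmod (x $ i))\<^sup>2 * (cmod (y $ f))\<^sup>2) \<noteq> 0"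
      using False that by simp
    ultimately show ?thesis by (metis mult_right_cancel)
  qed
  have via_second: "h x y (i, j) (e, f) = h x 1 (i, j) (e, j) * b j y" if "x $ e \<noteq> 0" for x y i j
  proof (cases "y $ j = 0")
    case True
    then have "cmod (h x y (i, j) (e, f)) = 0" "cmod (b j y) = 0" by (simp_all add: cmod_h cmod_b)
    then show ?thesis by simp
  next
    case False
    have "h x y (i, j) (e, f) * h x y (e, j) (e, j) = h x y (i, j) (e, j) * h x y (e, j) (e, f)"
      by (rule minor)
    then have "h x y (i, j) (e, f) * of_real ((cmod (x $ e))\<^sup>2 * (cmod (y $ j))\<^sup>2)
        = (h x 1 (i, j) (e, j) * b j y) * of_real ((cmod (x $ e))\<^sup>2 * (cmod (y $ j))\<^sup>2)"
      unfolding h_diag first[of x y e j f] second[of x y i j e] b_def by (simp add: mult_ac)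
    moreover have "complex_of_real ((cmod (x $ e))\<^sup>2 * (cmod (y $ j))\<^sup>2) \<noteq> 0"
      using False that by simp
    ultimately show ?thesis by (metis mult_right_cancel)
  qed
  define \<kappa> where "\<kappa> p = h 1 1 p (fst p, f) / b (snd p) 1" for p
  have \<kappa>: "cmod (\<kappa> p) = 1" for p
    by (cases p) (simp add: \<kappa>_def norm_divide cmod_h cmod_b)
  have column: "h x y (i, j) (e, f) = \<kappa> (i, j) * a i x * b j y" if "y $ f \<noteq> 0" for x y i j
  proof -
    have nz: "a i 1 \<noteq> 0" "b j 1 \<noteq> 0"
      using cmod_a[of i 1] cmod_b[of j 1] by auto
    have at_y: "h 1 y (i, j) (i, f) * a i 1 = h 1 1 (i, j) (e, j) * b j y"
      using via_first[OF that, of 1 i j] via_second[of 1 y i j] by simp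
    have at_1: "h 1 1 (i, j) (i, f) * a i 1 = h 1 1 (i, j) (e, j) * b j 1"
      using via_first[of 1 1 i j] via_second[of 1 1 i j] by simp
    have "a i 1 * (h 1 y (i, j) (i, f) * b j 1) = (h 1 y (i, j) (i, f) * a i 1) * b j 1"
      by simp
    also have "\<dots> = (h 1 1 (i, j) (e, j) * b j 1) * b j y"
      unfolding at_y by simp
    also have "\<dots> = a i 1 * (h 1 1 (i, j) (i, f) * b j y)"
      unfolding at_1[symmetric] by simp
    finally have "h 1 y (i, j) (i, f) = \<kappa> (i, j) * b j y"
      using nz by (simp add: \<kappa>_def eq_divide_eq)
    then show ?thesis using via_first[OF that, of x i j] by (simp add: mult_ac)
  qed
  have entry: "h x y (i, j) (k, l)
      = \<kappa> (i, j) * cnj (\<kappa> (k, l)) * L1 (outer x x) $ i $ k * L2 (outer y y) $ j $ l"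
    if "x $ e \<noteq> 0" "y $ f \<noteq> 0" for x y i j k l
  proof -
    have L1: "L1 (outer x x) $ i $ k = h x 1 (i, f) (k, f)" by (simp add: L1_nth h_def)
    have L2: "L2 (outer y y) $ j $ l = h 1 y (e, j) (e, l)" by (simp add: L2_nth h_def)
    have L1': "L1 (outer x x) $ i $ k * of_real ((cmod (x $ e))\<^sup>2) = a i x * cnj (a k x)"
      using minor[of x 1 "(i, f)" "(k, f)" "(e, f)"] herm[of x 1 "(e, f)" "(k, f)"]
      by (simp add: L1 a_def h_diag)
    have L2': "L2 (outer y y) $ j $ l * of_real ((cmod (y $ f))\<^sup>2) = b j y * cnj (b l y)"
      using minor[of 1 y "(e, j)" "(e, l)" "(e, f)"] herm[of 1 y "(e, f)" "(e, l)"]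
      by (simp add: L2 b_def h_diag)
    let ?n = "complex_of_real ((cmod (x $ e))\<^sup>2 * (cmod (y $ f))\<^sup>2)"
    have "h x y (i, j) (k, l) * ?n = h x y (i, j) (e, f) * cnj (h x y (k, l) (e, f))"
      using minor[of x y "(i, j)" "(k, l)" "(e, f)"] herm[of x y "(e, f)" "(k, l)"]
      by (simp add: h_diag)
    also have "\<dots> = \<kappa> (i, j) * cnj (\<kappa> (k, l)) * (a i x * cnj (a k x)) * (b j y * cnj (b l y))"
      by (simp add: column[OF that(2)] mult_ac)
    also have "\<dots> = (\<kappa> (i, j) * cnj (\<kappa> (k, l)) * L1 (outer x x) $ i $ k * L2 (outer y y) $ j $ l) * ?n"
      unfolding L1'[symmetric] L2'[symmetric] by (simp add: mult_ac)
    finally show ?thesis using that by simp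
  qed
  have "\<psi> (A \<otimes> B) $ (i, j) $ (k, l) = \<kappa> (i, j) * cnj (\<kappa> (k, l)) * L1 A $ i $ k * L2 B $ j $ l"
    for A B i j k l
  proof (rule matrix_functional_eqI[OF fn2, where i = f])
    have "complex_linear L1" "complex_linear L2"
      using \<psi> by (simp_all add: complex_linear_iff vec_eq_iff L1_nth L2_nth kronecker_linear)
    then show "matrix_functional (\<lambda>B. \<kappa> (i, j) * cnj (\<kappa> (k, l)) * L1 A $ i $ k * L2 B $ j $ l)"
      by (simp add: matrix_functional_def complex_linear_iff algebra_simps)
    fix y :: "complex ^ 'n" assume y: "y $ f \<noteq> 0"
    show "\<psi> (A \<otimes> outer y y) $ (i, j) $ (k, l)
        = \<kappa> (i, j) * cnj (\<kappa> (k, l)) * L1 A $ i $ k * L2 (outer y y) $ j $ l"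
    proof (rule matrix_functional_eqI[OF fn1, where i = e])
      show "matrix_functional (\<lambda>A. \<kappa> (i, j) * cnj (\<kappa> (k, l)) * L1 A $ i $ k * L2 (outer y y) $ j $ l)"
        using \<open>complex_linear L1\<close> by (simp add: matrix_functional_def complex_linear_iff algebra_simps)
    qed (use entry y in \<open>simp add: h_def\<close>)
  qed
  then have "\<psi> (A \<otimes> B) $ p $ q = (\<kappa> p * d1 (fst p) * d2 (snd p)) * cnj (\<kappa> q * d1 (fst q) * d2 (snd q))
      * (\<tau>1 A \<otimes> \<tau>2 B) $ p $ q" for A B p q
    by (cases p; cases q) (simp add: d1(3) d2(3) mult_ac)
  moreover have "cmod (\<kappa> p * d1 (fst p) * d2 (snd p)) = 1" for p
    by (simp add: norm_mult \<kappa> d1 d2)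
  ultimately show ?thesis
    using that[of "\<lambda>p. \<kappa> p * d1 (fst p) * d2 (snd p)" \<tau>1 \<tau>2] d1(2) d2(2) by blast
qed

section \<open>Classification of the preservers\<close>

lemma diag_mat_conj_nth: "(diag_mat d ** A ** conj_transpose (diag_mat d)) $ p $ q = d p * cnj (d q) * A $ p $ q"
proof -
  have "(diag_mat d ** A) $ p $ r = d p * A $ p $ r" for r
    by (simp add: matrix_matrix_mult_def if_distrib if_distribR cong: if_cong)
  moreover have "(B ** conj_transpose (diag_mat d)) $ p $ q = B $ p $ q * cnj (d q)" for B :: "'a cmat"
    by (simp add: matrix_matrix_mult_def if_distrib if_distribR cong: if_cong)
  ultimately show ?thesis by simp
qed

lemma radius_preserving_form:
  fixes \<phi> :: "('m::finite \<times> 'n::finite) cmat \<Rightarrow> ('m \<times> 'n) cmat"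
  assumes \<phi>: "radius_preserving \<phi>"
  obtains U \<xi> \<tau>1 \<tau>2 where "unitary U" "cmod \<xi> = 1"
    "\<tau>1 = id \<or> \<tau>1 = transpose" "\<tau>2 = id \<or> \<tau>2 = transpose"
    "\<And>A B. \<phi> (A \<otimes> B) = mat_scale \<xi> (U ** (\<tau>1 A \<otimes> \<tau>2 B) ** conj_transpose U)"
proof -
  obtain U \<xi> where U: "unitary U" and \<xi>: "cmod \<xi> = 1"
    and unit: "\<And>p. \<phi> (mat_unit p p) = mat_scale \<xi> (U ** mat_unit p p ** conj_transpose U)"
    and rank1: "\<And>x y. \<exists>u. \<phi> (outer x x \<otimes> outer y y) = mat_scale \<xi> (outer u u)"
    using radius_preserving_normalize[OF \<phi>] by blast
  define \<psi> where "\<psi> X = conj_transpose U ** mat_scale (cnj \<xi>) (\<phi> X) ** U" for X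
  have "complex_linear \<phi>" using \<phi> by (simp add: radius_preserving_def)
  from complex_linear_conj[OF this, of "mat_scale (cnj \<xi>) (conj_transpose U)" "mat 1" "mat 1" U]
  have lin: "complex_linear \<psi>"
    by (simp add: \<psi>_def[abs_def] mat_scale_mult_left mat_scale_mult_right)
  have units: "\<psi> (mat_unit p p) = mat_unit p p" for p
    by (simp add: \<psi>_def unit cnj_mult_self \<xi> unitary_conj_cancel U)
  have outer: "\<exists>u. \<psi> (outer x x \<otimes> outer y y) = outer u u" for x y
  proof -
    obtain u where "\<phi> (outer x x \<otimes> outer y y) = mat_scale \<xi> (outer u u)" using rank1 by blast
    then have "\<psi> (outer x x \<otimes> outer y y) = conj_transpose U ** outer u u ** conj_transpose (conj_transpose U)"
      by (simp add: \<psi>_def cnj_mult_self \<xi>)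
    then show ?thesis unfolding outer_conj by blast
  qed
  obtain d \<tau>1 \<tau>2 where d: "\<And>p. cmod (d p) = 1"
    and \<tau>: "\<tau>1 = id \<or> \<tau>1 = transpose" "\<tau>2 = id \<or> \<tau>2 = transpose"
    and entries: "\<And>A B p q. \<psi> (A \<otimes> B) $ p $ q = d p * cnj (d q) * (\<tau>1 A \<otimes> \<tau>2 B) $ p $ q"
    using product_rank_one_classification[OF lin units outer] by blast
  have "\<psi> (A \<otimes> B) = diag_mat d ** (\<tau>1 A \<otimes> \<tau>2 B) ** conj_transpose (diag_mat d)" for A B
    by (simp add: vec_eq_iff diag_mat_conj_nth entries del: kronecker_nth)
  moreover have "\<phi> X = mat_scale \<xi> (U ** \<psi> X ** conj_transpose U)" for X
    by (simp add: \<psi>_def mat_scale_mult_left mat_scale_mult_right cnj_mult_self \<xi> unitary_conj_cancel U)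
  ultimately have "\<phi> (A \<otimes> B) = mat_scale \<xi> ((U ** diag_mat d) ** (\<tau>1 A \<otimes> \<tau>2 B)
      ** conj_transpose (U ** diag_mat d))" for A B
    by (simp add: conj_transpose_mult matrix_mul_assoc)
  moreover have "unitary (U ** diag_mat d)"
    by (simp add: U d unitary_mult unitary_diag_mat)
  ultimately show ?thesis using that \<xi> \<tau> by blast
qed

text \<open>Transposing both factors is transposing the Kronecker product. If only the factor that
  is not two-dimensional is transposed, transposing the whole product moves the
  transposition to the two-dimensional one.\<close>

lemma numerical_radius_factorwise_transpose:
  fixes A :: "'m::finite cmat" and B :: "'n::finite cmat"
  assumes "\<tau>1 = id \<or> \<tau>1 = transpose" "\<tau>2 = id \<or> \<tau>2 = transpose"
    and "CARD('m) = 2 \<or> CARD('n) = 2 \<or> (\<tau>1 = id \<and> \<tau>2 = id) \<or> (\<tau>1 = transpose \<and> \<tau>2 = transpose)"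
  shows "numerical_radius (\<tau>1 A \<otimes> \<tau>2 B) = numerical_radius (A \<otimes> B)"
proof -
  have both: "numerical_radius (transpose A \<otimes> transpose B) = numerical_radius (A \<otimes> B)" for A :: "'m cmat" and B :: "'n cmat"
    by (metis numerical_radius_transpose transpose_kronecker)
  have "numerical_radius (A \<otimes> transpose B) = numerical_radius (A \<otimes> B)"
    and "numerical_radius (transpose A \<otimes> B) = numerical_radius (A \<otimes> B)" if "CARD('m) = 2 \<or> CARD('n) = 2"
    using that numerical_radius_transpose_left numerical_radius_transpose_right both
    by (metis transpose_transpose)+
  then show ?thesis using assms both by auto
qed

lemma same_type_if_dimensions_ge_3:
  fixes \<tau>1 :: "'m::finite cmat \<Rightarrow> 'm cmat" and \<tau>2 :: "'n::finite cmat \<Rightarrow> 'n cmat"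
  assumes "CARD('m) \<ge> 3" "CARD('n) \<ge> 3"
    and \<tau>: "\<tau>1 = id \<or> \<tau>1 = transpose" "\<tau>2 = id \<or> \<tau>2 = transpose"
    and eq: "\<And>A B. numerical_radius (\<tau>1 A \<otimes> \<tau>2 B) = numerical_radius (A \<otimes> B)"
  shows "(\<tau>1 = id \<and> \<tau>2 = id) \<or> (\<tau>1 = transpose \<and> \<tau>2 = transpose)"
proof -
  obtain A :: "'m cmat" and B :: "'n cmat"
    where less: "numerical_radius (A \<otimes> transpose B) < numerical_radius (A \<otimes> B)"
    using partial_transpose_not_radius_preserving[OF assms(1,2)] by blast
  have "numerical_radius (transpose A \<otimes> B) = numerical_radius (A \<otimes> transpose B)"
    using numerical_radius_transpose[of "transpose A \<otimes> B"] by (simp add: transpose_kronecker)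
  with less eq[of A B] \<tau> show ?thesis by auto
qed

theorem theorem2p4:
  fixes \<phi> :: "('m::finite \<times> 'n::finite) cmat \<Rightarrow> ('m \<times> 'n) cmat"
  assumes "CARD('m) \<ge> 2" and "CARD('n) \<ge> 2"
    and "complex_linear \<phi>"
  shows "(\<forall>(A :: 'm cmat) (B :: 'n cmat).
            numerical_radius (\<phi> (A \<otimes> B)) = numerical_radius (A \<otimes> B))
    \<longleftrightarrow>
    (\<exists>(U :: ('m \<times> 'n) cmat) (\<xi> :: complex)
        (\<phi>1 :: 'm cmat \<Rightarrow> 'm cmat) (\<phi>2 :: 'n cmat \<Rightarrow> 'n cmat).
        unitary U \<and> cmod \<xi> = 1 \<and>
        (\<phi>1 = id \<or> \<phi>1 = transpose) \<and> (\<phi>2 = id \<or> \<phi>2 = transpose) \<and>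
        (\<forall>A B. \<phi> (A \<otimes> B) = mat_scale \<xi> (U ** (\<phi>1 A \<otimes> \<phi>2 B) ** conj_transpose U)) \<and>
        (CARD('m) \<ge> 3 \<and> CARD('n) \<ge> 3 \<longrightarrow>
          (\<phi>1 = id \<and> \<phi>2 = id) \<or> (\<phi>1 = transpose \<and> \<phi>2 = transpose)))"
  (is "?preserving \<longleftrightarrow> ?form")
proof
  assume pres: ?preserving
  then have "radius_preserving \<phi>"
    using assms(3) by (simp add: radius_preserving_def)
  then obtain U \<xi> \<tau>1 \<tau>2 where U: "unitary U" and \<xi>: "cmod \<xi> = 1"
    and \<tau>: "\<tau>1 = id \<or> \<tau>1 = transpose" "\<tau>2 = id \<or> \<tau>2 = transpose"
    and eq: "\<And>A B. \<phi> (A \<otimes> B) = mat_scale \<xi> (U ** (\<tau>1 A \<otimes> \<tau>2 B) ** conj_transpose U)"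
    using radius_preserving_form by blast
  have "numerical_radius (\<tau>1 A \<otimes> \<tau>2 B) = numerical_radius (A \<otimes> B)" for A B
    using pres by (simp add: eq numerical_radius_scale numerical_radius_unitary U \<xi>)
  then have "CARD('m) \<ge> 3 \<and> CARD('n) \<ge> 3 \<longrightarrow> (\<tau>1 = id \<and> \<tau>2 = id) \<or> (\<tau>1 = transpose \<and> \<tau>2 = transpose)"
    using same_type_if_dimensions_ge_3 \<tau> by blast
  with U \<xi> \<tau> eq show ?form by blast
next
  assume ?form
  then obtain U \<xi> \<tau>1 \<tau>2 where U: "unitary U" and \<xi>: "cmod \<xi> = 1"
    and \<tau>: "\<tau>1 = id \<or> \<tau>1 = transpose" "\<tau>2 = id \<or> \<tau>2 = transpose"
    and eq: "\<And>A B. \<phi> (A \<otimes> B) = mat_scale \<xi> (U ** (\<tau>1 A \<otimes> \<tau>2 B) ** conj_transpose U)"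
    and same: "CARD('m) \<ge> 3 \<and> CARD('n) \<ge> 3 \<longrightarrow> (\<tau>1 = id \<and> \<tau>2 = id) \<or> (\<tau>1 = transpose \<and> \<tau>2 = transpose)"
    by blast
  have dims: "CARD('m) = 2 \<or> CARD('n) = 2 \<or> (\<tau>1 = id \<and> \<tau>2 = id) \<or> (\<tau>1 = transpose \<and> \<tau>2 = transpose)"
    using same assms(1,2) by (cases "CARD('m) = 2"; cases "CARD('n) = 2") auto
  show ?preserving
    by (simp add: eq numerical_radius_scale numerical_radius_unitary U \<xi>
        numerical_radius_factorwise_transpose[OF \<tau> dims])
qed

end
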